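(* Suppose $A_0$ is a defective matrix with Jordan chain vectors $x_0$ and $j_0$, and $A_\varepsilon$ is a nearby matrix such that $\|A_\varepsilon-A_0\|=\mathcal{O}(\varepsilon)$. Let $x_\varepsilon$ and $j_\varepsilon$ be the vectors constructed from $A_\varepsilon$ by the procedure described in the context (computation of the basis $U_\varepsilon=(u_1,u_2)$, followed by the construction of $x_\varepsilon,j_\varepsilon$ from $U_\varepsilon$). Then $$\|x_0-x_\varepsilon\|=\mathcal{O}(\varepsilon)\qquad\text{and}\qquad \|j_0-j_\varepsilon\|=\mathcal{O}(\varepsilon).$$
   Context: Setting: $A_0$ has a $2\times2$ Jordan block for an eigenvalue $\lambda_0$, with eigenvector $x_0$ and Jordan vector $j_0$ satisfying $A_0x_0=\lambda_0x_0$ and $A_0j_0=\lambda_0j_0+x_0$. The normalization adopted for the Jordan chain is $\|x_0\|=1$ and $x_0^*j_0=0$. Here $^*$ is the conjugate transpose and $\mathbb{I}$ the identity. The nearby matrix $A_\varepsilon$ has two nearly degenerate eigenvalues near $\lambda_0$, and a good approximation $\mu$ of $\lambda_0$ is given. Step A (basis of the invariant subspace of $A_\varepsilon$ for its two nearly degenerate eigenvalues). Find an eigenvector $u_1$ of $A_\varepsilon$ with eigenvalue near $\mu$ (e.g. by inverse iteration), normalized to unit length. Put $P^\perp=\mathbb{I}-u_1u_1^*$. Start with $\lambda'=\mu$ and $u_2$ a random vector orthogonal to $u_1$, and iterate until $\|(P^\perp A_\varepsilon-\lambda'\mathbb{I})u_2\|$ is below a tolerance: compute $v=(P^\perp A_\varepsilon-\lambda'\mathbb{I})^{-1}u_2$,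 then replace $u_2$ by $v/\|v\|$ and $\lambda'$ by $u_2^*P^\perp A_\varepsilon u_2$. (In an equivalent variant, $v$ is computed as $P^\perp(A_\varepsilon-\lambda'\mathbb{I})^{-1}u_2$ and then iteratively refined: with $e=u_2-P^\perp(A_\varepsilon-\lambda'\mathbb{I})v$, while $\|e\|$ exceeds the tolerance, replace $v$ by $v+P^\perp(A_\varepsilon-\lambda'\mathbb{I})^{-1}e$ and recompute $e$.) Thus $u_2$ is an eigenvector of $P^\perp A_\varepsilon$ orthogonal to $u_1$. Set $U_\varepsilon=(u_1,u_2)$, whose columns are orthonormal and span the invariant subspace. Step B (approximate Jordan chain). Let $S_\varepsilon=U_\varepsilon^*A_\varepsilon U_\varepsilon$ with entries $s_{ij}$. Set $\lambda_\varepsilon=(s_{22}+s_{11})/2$ and $\gamma=(s_{22}-s_{11})/(2s_{12})$. Set $x_\varepsilon=u_1+\gamma u_2$ and $j_\varepsilon=u_2/s_{12}$. Finally, normalize $x_\varepsilon$ and $j_\varepsilon$.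
   Formalization: The bounds are proved up to one common unit-modulus phase c(ε) multiplying both x_0 and j_0, since the phase of the unit eigenvector u_1 is arbitrary; "normalize" is read as the adopted chain normalization ‖x‖=1, x^*j=0 with a common scaling of x and j. *)

theory Defs
  imports
    "HOL-Analysis.Analysis"
    "HOL-Computational_Algebra.Polynomial"
    "HOL-Library.Landau_Symbols"
begin

definition hdot :: "complex^'n \<Rightarrow> complex^'n \<Rightarrow> complex" where
  "hdot x y = (\<Sum>i\<in>UNIV. cnj (x $ i) * y $ i)"

definition ctranspose :: "complex^'n^'m \<Rightarrow> complex^'m^'n" where
  "ctranspose A = map_matrix cnj (transpose A)"

definition eigenvalue :: "complex^'n^'n \<Rightarrow> complex \<Rightarrow> bool" where
  "eigenvalue A l \<longleftrightarrow> (\<exists>v. v \<noteq> 0 \<and> A *v v = l *s v)"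

definition charpoly :: "complex^'n^'n \<Rightarrow> complex poly" where
  "charpoly A = det (mat [:0, 1:] - map_matrix (\<lambda>a. [:a:]) A)"

definition alg_mult :: "complex^'n^'n \<Rightarrow> complex \<Rightarrow> nat" where
  "alg_mult A l = order l (charpoly A)"

definition jordan_chain :: "complex^'n^'n \<Rightarrow> complex \<Rightarrow> complex^'n \<Rightarrow> complex^'n \<Rightarrow> bool" where
  "jordan_chain A l x j \<longleftrightarrow> x \<noteq> 0 \<and> A *v x = l *s x \<and> A *v j = l *s j + x"

text \<open>
  The normalization of a Jordan chain. Note that \<open>j\<close> is not scaled to unit length: its length is
  tied to that of \<open>x\<close> by \<open>A j = l j + x\<close>.
\<close>

definition normalized_chain :: "complex^'n \<Rightarrow> complex^'n \<Rightarrow> bool" where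
  "normalized_chain x j \<longleftrightarrow> norm x = 1 \<and> hdot x j = 0"

text \<open>
  A matrix whose eigenvalue \<open>l\<close> has exactly one Jordan block, of size two: there is a chain
  of length two, and it exhausts the algebraic multiplicity of \<open>l\<close>.
\<close>

definition defective2 :: "complex^'n^'n \<Rightarrow> complex \<Rightarrow> complex^'n \<Rightarrow> complex^'n \<Rightarrow> bool" where
  "defective2 A l x j \<longleftrightarrow> alg_mult A l = 2 \<and> jordan_chain A l x j"


subsection \<open>Basis of the invariant subspace\<close>

definition proj_perp :: "complex^'n \<Rightarrow> complex^'n^'n" where
  "proj_perp u = mat 1 - (\<chi> i k. u $ i * cnj (u $ k))"

text \<open>
  \<open>invariant_basis A \<mu> r tol u1 u2\<close>: \<open>u1\<close> is a unit eigenvector of \<open>A\<close>, and \<open>u2\<close> is a unit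
  vector orthogonal to \<open>u1\<close> passing the stopping test of the inverse iteration for
  \<open>proj_perp u1 ** A\<close>, both with eigenvalue near \<open>\<mu>\<close>, that is, within distance \<open>r\<close>.
  For \<open>tol = 0\<close>, \<open>u2\<close> is an exact eigenvector of \<open>proj_perp u1 ** A\<close>.
\<close>

definition invariant_basis ::
  "complex^'n^'n \<Rightarrow> complex \<Rightarrow> real \<Rightarrow> real \<Rightarrow> complex^'n \<Rightarrow> complex^'n \<Rightarrow> bool" where
  "invariant_basis A \<mu> r tol u1 u2 \<longleftrightarrow>
     (\<exists>l1\<in>cball \<mu> r. norm u1 = 1 \<and> A *v u1 = l1 *s u1) \<and>
     (\<exists>l2\<in>cball \<mu> r. norm u2 = 1 \<and> hdot u1 u2 = 0 \<and>
        norm ((proj_perp u1 ** A - mat l2) *v u2) \<le> tol)"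

text \<open>
  The inverse iteration itself; lemma \<open>inverse_iterate_basis\<close> below shows that whatever it
  returns is an \<open>invariant_basis\<close>.
\<close>

inductive inverse_iterate ::
  "complex^'n^'n \<Rightarrow> complex \<Rightarrow> complex^'n \<Rightarrow> complex^'n \<Rightarrow> complex \<Rightarrow> bool"
  for A \<mu> u1 where
  start: "norm u2 = 1 \<Longrightarrow> hdot u1 u2 = 0 \<Longrightarrow> inverse_iterate A \<mu> u1 u2 \<mu>"
| step: "inverse_iterate A \<mu> u1 u2 l \<Longrightarrow> invertible (proj_perp u1 ** A - mat l) \<Longrightarrow>
    v = matrix_inv (proj_perp u1 ** A - mat l) *v u2 \<Longrightarrow> w = (1 / norm v) *\<^sub>R v \<Longrightarrow>
    inverse_iterate A \<mu> u1 w (hdot w ((proj_perp u1 ** A) *v w))"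


subsection \<open>Approximate Jordan chain\<close>

definition basis_mat :: "complex^'n \<Rightarrow> complex^'n \<Rightarrow> complex^2^'n" where
  "basis_mat u1 u2 = (\<chi> i k. if k = 1 then u1 $ i else u2 $ i)"

definition schur_block :: "complex^'n^'n \<Rightarrow> complex^'n \<Rightarrow> complex^'n \<Rightarrow> complex^2^2" where
  "schur_block A u1 u2 = ctranspose (basis_mat u1 u2) ** A ** basis_mat u1 u2"

definition raw_chain :: "complex^'n^'n \<Rightarrow> complex^'n \<Rightarrow> complex^'n \<Rightarrow> (complex^'n) \<times> (complex^'n)" where
  "raw_chain A u1 u2 =
     (let S = schur_block A u1 u2;
          \<gamma> = (S $ 2 $ 2 - S $ 1 $ 1) / (2 * S $ 1 $ 2)
      in (u1 + \<gamma> *s u2, (1 / S $ 1 $ 2) *s u2))"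

text \<open>
  Scaling both vectors by the same factor and adding a multiple of \<open>x\<close> to \<open>j\<close> are the operations
  on a pair that preserve \<open>A j = l j + x\<close> when \<open>x\<close> is an eigenvector for \<open>l\<close>.
\<close>

definition normalize_chain :: "(complex^'n) \<times> (complex^'n) \<Rightarrow> (complex^'n) \<times> (complex^'n)" where
  "normalize_chain = (\<lambda>(x, j).
     ((1 / norm x) *\<^sub>R x, (1 / norm x) *\<^sub>R (j - (hdot x j / hdot x x) *s x)))"

definition approx_x :: "complex^'n^'n \<Rightarrow> complex^'n \<Rightarrow> complex^'n \<Rightarrow> complex^'n" where
  "approx_x A u1 u2 = fst (normalize_chain (raw_chain A u1 u2))"

definition approx_j :: "complex^'n^'n \<Rightarrow> complex^'n \<Rightarrow> complex^'n \<Rightarrow> complex^'n" where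
  "approx_j A u1 u2 = snd (normalize_chain (raw_chain A u1 u2))"


subsection \<open>Consistency of the definitions\<close>

lemma hdot_self: "hdot x x = complex_of_real ((norm x)\<^sup>2)"
proof -
  have "cnj (x $ i) * x $ i = complex_of_real ((norm (x $ i))\<^sup>2)" for i
    by (metis complex_norm_square mult.commute of_real_power)
  then show ?thesis
    by (simp add: hdot_def norm_vec_def L2_set_def real_sqrt_pow2 sum_nonneg)
qed

lemma hdot_add: "hdot u (v + w) = hdot u v + hdot u w"
  by (simp add: hdot_def sum.distrib algebra_simps)

lemma hdot_diff: "hdot u (v - w) = hdot u v - hdot u w"
  by (simp add: hdot_def sum_subtractf algebra_simps)

lemma hdot_smult: "hdot u (c *s v) = c * hdot u v"
  by (simp add: hdot_def sum_distrib_left mult.left_commute)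

lemma scaleR_vec_smult: "a *\<^sub>R (v :: complex^'n) = complex_of_real a *s v"
  by (simp add: vec_eq_iff complex_eq_iff)

lemma mat_mult_vec: "mat c *v (v :: complex^'n) = c *s v"
  by (simp add: vec_eq_iff matrix_vector_mult_def mat_def if_distrib [of "\<lambda>a. a * _"] cong: if_cong)

lemma proj_perp_vec: "proj_perp u *v v = v - hdot u v *s u"
  by (simp add: vec_eq_iff proj_perp_def matrix_vector_mult_diff_rdistrib mat_mult_vec)
     (simp add: matrix_vector_mult_def hdot_def sum_distrib_left sum_distrib_right mult_ac)

lemma mult_matrix_inv:
  fixes M :: "complex^'n^'n"
  shows "invertible M \<Longrightarrow> M ** matrix_inv M = mat 1"
  unfolding matrix_inv_def invertible_def by (rule conjunct1 [OF someI_ex])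

lemma inverse_iterate_unit_orth:
  assumes "inverse_iterate A \<mu> u1 u2 l" and u1: "norm u1 = 1"
  shows "norm u2 = 1 \<and> hdot u1 u2 = 0"
  using assms(1)
proof induction
  case (start u2)
  then show ?case by simp
next
  case (step u2 l v w)
  let ?M = "proj_perp u1 ** A - mat l"
  have Mv: "?M *v v = u2"
    using step.hyps by (simp add: mult_matrix_inv matrix_vector_mul_assoc)
  have orth: "hdot u1 (?M *v z) = - l * hdot u1 z" for z
    by (simp add: matrix_vector_mult_diff_rdistrib mat_mult_vec hdot_diff hdot_smult
        matrix_vector_mul_assoc [symmetric] proj_perp_vec hdot_self u1)
  have "?M *v (matrix_inv ?M *v u1) = u1"
    using step.hyps by (simp add: mult_matrix_inv matrix_vector_mul_assoc)
  with orth [of "matrix_inv ?M *v u1"] have "l \<noteq> 0"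
    by (auto simp: hdot_self u1)
  with orth [of v] Mv step.IH have "hdot u1 v = 0"
    by simp
  moreover have "v \<noteq> 0"
    using Mv step.IH by auto
  ultimately show ?case
    using step.hyps(4) hdot_smult [of u1 "complex_of_real (1 / norm v)" v]
    unfolding scaleR_vec_smult [symmetric] by simp
qed

lemma inverse_iterate_basis:
  assumes "norm u1 = 1" "A *v u1 = l1 *s u1" "dist \<mu> l1 \<le> r"
    and "inverse_iterate A \<mu> u1 u2 l2" "dist \<mu> l2 \<le> r"
    and "norm ((proj_perp u1 ** A - mat l2) *v u2) \<le> tol"
  shows "invariant_basis A \<mu> r tol u1 u2"
  using assms inverse_iterate_unit_orth [of A \<mu> u1 u2 l2]
  unfolding invariant_basis_def by (auto simp: mem_cball)

lemma normalize_chain_normalized: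
  assumes "normalize_chain (x, j) = (x', j')" "x \<noteq> 0"
  shows "normalized_chain x' j'"
proof -
  let ?d = "j - (hdot x j / hdot x x) *s x"
  have eqs: "x' = (1 / norm x) *\<^sub>R x" "j' = (1 / norm x) *\<^sub>R ?d"
    using assms(1) by (auto simp: normalize_chain_def)
  have "hdot x ?d = 0"
    using assms(2) by (simp add: hdot_diff hdot_smult hdot_self)
  moreover have "hdot (a *\<^sub>R y) (b *\<^sub>R z) = of_real (a * b) * hdot y z"
    for a b :: real and y z :: "complex^'a"
    by (simp add: hdot_def sum_distrib_left scaleR_conv_of_real [where 'a = complex] mult_ac)
  ultimately show ?thesis
    using assms(2) by (simp add: normalized_chain_def eqs del: of_real_mult)
qed

end

theory Submission
  imports Defs
begin

text \<open>
  Let \<open>V\<close> be the span of \<open>x0\<close> and \<open>j0\<close>. As \<open>l0\<close> has algebraic multiplicity two, \<open>A0 - l\<close> acts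
  injectively on the quotient by \<open>V\<close> for every \<open>l\<close> in the compact disc around \<open>\<mu>\<close>, so its inverse there
  is uniformly bounded. Since \<open>u1\<close> and \<open>u2\<close> span an invariant subspace of \<open>A0\<close> up to \<open>O(\<epsilon>)\<close> with
  eigenvalues \<open>l1, l2\<close> in the disc, both lie in \<open>V\<close> up to \<open>O(\<epsilon>)\<close>. In the coordinates given by \<open>x0\<close>
  and \<open>j0\<close>, the Schur block is similar, up to \<open>O(\<epsilon>)\<close>, to the Jordan block; comparing traces yields
  \<open>l1 + l2 = 2 * l0 + O(\<epsilon>)\<close>, although \<open>l1\<close> and \<open>l2\<close> separately are only \<open>O(sqrt \<epsilon>)\<close> close to \<open>l0\<close>.
  Hence \<open>s12 * x = (A0 - l0) u2 + O(\<epsilon>)\<close>, which is a multiple of \<open>x0\<close> up to \<open>O(\<epsilon>)\<close>, and the entry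
  \<open>s12\<close> stays away from zero because the Jordan block is not diagonalizable.
\<close>

section \<open>Characteristic polynomial and Jordan chains\<close>

text \<open>The Leibniz formula is built from sums, products and signs alone. The lemma is applied
  to the evaluation of polynomials at a point and to the embedding of constants into
  polynomials.\<close>

lemma det_hom:
  fixes h :: "'a::comm_ring_1 \<Rightarrow> 'b::comm_ring_1" and M :: "'a^'n^'n"
  assumes h1: "h 1 = 1" and hadd: "\<And>x y. h (x + y) = h x + h y" and hmult: "\<And>x y. h (x * y) = h x * h y"
  shows "det (map_matrix h M) = h (det M)"
proof -
  have h0: "h 0 = 0"
    using hadd [of 0 0] by simp
  have hm1: "h (- 1) = - 1"
    using hadd [of 1 "- 1"] by (simp add: h0 h1 eq_neg_iff_add_eq_0 add.commute)
  have hsum: "h (sum f S) = (\<Sum>x\<in>S. h (f x))" for f :: "('n \<Rightarrow> 'n) \<Rightarrow> 'a" and S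
    by (induction S rule: infinite_finite_induct) (auto simp: h0 hadd)
  have hprod: "h (prod f S) = (\<Prod>x\<in>S. h (f x))" for f :: "'n \<Rightarrow> 'a" and S
    by (induction S rule: infinite_finite_induct) (auto simp: h1 hmult)
  have hsign: "h (of_int (sign p)) = of_int (sign p)" for p :: "'n \<Rightarrow> 'n"
    by (cases p rule: sign_cases) (simp_all add: h1 hm1)
  show ?thesis
    unfolding det_def hsum hmult hprod hsign by (simp add: map_matrix_def)
qed

text \<open>Applying \<open>N\<close> to every row is multiplication by \<open>transpose N\<close>
  on the right.\<close>

lemma det_rows_mult_vec:
  fixes N :: "'a::comm_ring_1^'n^'n"
  shows "det (\<chi> k. N *v f k) = det N * det (\<chi> k. f k)"
proof -
  have "(\<chi> k. N *v f k) = (\<chi> k. f k) ** transpose N"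
    by (simp add: vec_eq_iff matrix_vector_mult_def matrix_matrix_mult_def transpose_def mult.commute)
  then show ?thesis
    by (simp add: det_mul mult.commute)
qed

lemma det_rows_smult:
  fixes f :: "'n \<Rightarrow> 'a::comm_ring_1^'n"
  shows "det (\<chi> k. (f(i := c *s v)) k) = c * det (\<chi> k. (f(i := v)) k)"
  using det_row_mul [of i c "\<lambda>_. v" f] by (simp add: fun_upd_def)

lemma det_rows_diff_smult:
  fixes f :: "'n \<Rightarrow> 'a::comm_ring_1^'n"
  assumes "i \<noteq> j"
  shows "det (\<chi> k. (f(i := v - c *s f j)) k) = det (\<chi> k. (f(i := v)) k)"
proof -
  have "row i (\<chi> k. (f(i := f j)) k) = row j (\<chi> k. (f(i := f j)) k)"
    using assms by (simp add: row_def)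
  then have "det (\<chi> k. (f(i := f j)) k) = 0"
    using det_identical_rows [OF assms] by blast
  moreover have eq: "v - c *s f j = v + (- c) *s f j"
    by (simp add: vec_eq_iff)
  ultimately show ?thesis
    unfolding eq
    using det_row_add [of i "\<lambda>_. v" "\<lambda>_. (- c) *s f j" f] det_rows_smult [of f i "- c" "f j"]
    by (simp add: fun_upd_def del: add_uminus_conv_diff)
qed

text \<open>Each of the three rows becomes a multiple of \<open>s\<close> after row operations: once
  \<open>s\<close> is pulled out of row \<open>i\<close>, that row is \<open>x\<close> and clears
  \<open>x\<close> from row \<open>j\<close>; pulling \<open>s\<close> out of row \<open>j\<close>
  leaves \<open>y\<close>, and \<open>x\<close> and \<open>y\<close> then clear row
  \<open>k\<close>. The rows have the shape that the characteristic matrix produces on a chain of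
  three vectors.\<close>

lemma det_triangular_rows:
  fixes g :: "'n \<Rightarrow> 'a::comm_ring_1^'n"
  assumes "i \<noteq> j" "i \<noteq> k" "j \<noteq> k"
    and gi: "g i = s *s x" and gj: "g j = s *s y - x" and gk: "g k = s *s z - a *s x - b *s y"
  shows "s ^ 3 dvd det (\<chi> m. g m)"
proof -
  let ?D = "\<lambda>f. det (\<chi> m. f m) :: 'a"
  let ?u = "s *s y - x" and ?v = "s *s z - a *s x - b *s y"
  have "g = g(j := ?u, k := ?v, i := s *s x)"
    using assms by (auto simp: fun_eq_iff)
  then have "?D g = s * ?D (g(j := ?u, k := ?v, i := x))"
    by (metis det_rows_smult)
  also have "g(j := ?u, k := ?v, i := x) = (g(k := ?v, i := x))(j := s *s y - 1 *s (g(k := ?v, i := x)) i)"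
    using assms(1-3) by (auto simp: fun_eq_iff)
  also have "?D \<dots> = s * ?D (g(k := ?v, i := x, j := y))"
    using det_rows_diff_smult [of j i "g(k := ?v, i := x)" "s *s y" 1, OF assms(1) [symmetric]]
    by (simp only: det_rows_smult)
  also have "g(k := ?v, i := x, j := y) = (g(i := x, j := y))(k := (s *s z - a *s x) - b *s (g(i := x, j := y)) j)"
    using assms(1-3) by (auto simp: fun_eq_iff)
  also have "?D \<dots> = ?D (g(i := x, j := y, k := s *s z - a *s x))"
    using assms(3) by (intro det_rows_diff_smult) auto
  also have "g(i := x, j := y, k := s *s z - a *s x) = (g(i := x, j := y))(k := s *s z - a *s (g(i := x, j := y)) i)"
    using assms(1-3) by (auto simp: fun_eq_iff)
  also have "?D \<dots> = ?D (g(i := x, j := y, k := s *s z))"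
    using assms(2) by (intro det_rows_diff_smult) auto
  also have "\<dots> = s * ?D (g(i := x, j := y, k := z))"
    by (rule det_rows_smult)
  finally have "?D g = s ^ 3 * ?D (g(i := x, j := y, k := z))"
    by (simp add: power3_eq_cube mult.assoc)
  then show ?thesis
    by simp
qed

lemma norm_smult: "norm (c *s v) = norm c * norm (v :: complex^'n)"
  by (simp add: norm_vec_def norm_mult L2_set_right_distrib)

text \<open>A scalar larger than the operator norm cannot be an eigenvalue, so it is not a root.
  This allows the order of a root to be read off from divisibility.\<close>

lemma charpoly_nonzero: "charpoly A \<noteq> 0"
proof
  assume 0: "charpoly A = 0"
  define t where "t = complex_of_real (onorm ((*v) A) + 1)"
  have bl: "bounded_linear ((*v) A)"
    by (rule matrix_vector_mul_bounded_linear)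
  have nt: "norm t = onorm ((*v) A) + 1"
    unfolding t_def norm_of_real using onorm_pos_le [OF bl] by simp
  have "map_matrix (\<lambda>p. poly p t) (mat [:0, 1:] - map_matrix (\<lambda>a. [:a:]) A) = mat t - A"
    by (simp add: vec_eq_iff map_matrix_def mat_def)
  then have "det (mat t - A) = poly (charpoly A) t"
    using det_hom [of "\<lambda>p. poly p t" "mat [:0, 1:] - map_matrix (\<lambda>a. [:a:]) A"]
    by (simp add: charpoly_def)
  with 0 have "\<not> invertible (mat t - A)"
    by (simp add: invertible_det_nz)
  then obtain v where v: "(mat t - A) *v v = 0" "v \<noteq> 0"
    by (auto simp: invertible_left_inverse matrix_left_invertible_ker)
  then have "A *v v = t *s v"
    by (simp add: matrix_vector_mult_diff_rdistrib mat_mult_vec)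
  then have "norm t * norm v \<le> onorm ((*v) A) * norm v"
    using onorm [OF bl, of v] by (simp add: norm_smult)
  with v nt show False
    by simp
qed

text \<open>If \<open>w\<close> were outside the span, then \<open>x\<close>, \<open>j\<close>,
  \<open>w\<close> would extend to a basis. Written in that basis, the characteristic matrix has
  three rows from which the linear factor of \<open>l\<close> can be extracted, which makes the
  multiplicity at least three.\<close>

lemma alg_mult_two_span:
  fixes A :: "complex^'n^'n"
  assumes am: "alg_mult A l = 2" and x: "A *v x = l *s x" and j: "A *v j = l *s j + x"
    and w: "A *v w = l *s w + a *s x + b *s j"
    and "x \<noteq> 0"
  shows "\<exists>c d. w = c *s x + d *s j"
proof (rule ccontr)
  assume ns: "\<nexists>c d. w = c *s x + d *s j"
  have nj: "j \<noteq> c *s x" for c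
    using x j \<open>x \<noteq> 0\<close> by (auto simp: vector_scalar_commute mult.commute)
  have "w \<notin> vec.span {j, x}"
  proof
    assume "w \<in> vec.span {j, x}"
    then obtain d c where "w - d *s j = c *s x"
      by (auto simp: vec.span_breakdown_eq)
    with ns show False
      by (metis add.commute diff_add_cancel)
  qed
  moreover have "j \<notin> vec.span {x}"
    using nj by (auto simp: vec.span_breakdown_eq)
  ultimately have ind3: "vec.independent {w, j, x}"
    using \<open>x \<noteq> 0\<close> by (simp add: vec.independent_insert)
  obtain B where B: "{w, j, x} \<subseteq> B" "vec.independent B" "UNIV \<subseteq> vec.span B"
    using vec.maximal_independent_subset_extend [of "{w, j, x}" UNIV] ind3 by auto
  have spanB: "vec.span B = UNIV"
    using B(3) by auto
  then have "card B = CARD('n)" "finite B"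
    using vec.dim_eq_card [OF _ B(2), of UNIV] vec.finiteI_independent [OF B(2)]
    by (auto simp: card_cart_basis)
  then obtain f :: "'n \<Rightarrow> complex^'n" where f: "bij_betw f UNIV B"
    using finite_same_card_bij [of "UNIV :: 'n set" B] by auto
  have "x \<in> range f" "j \<in> range f" "w \<in> range f"
    using B(1) unfolding bij_betw_imp_surj_on [OF f] by simp_all
  then obtain i1 i2 i3 where i: "f i1 = x" "f i2 = j" "f i3 = w"
    unfolding image_iff by metis
  have "w \<noteq> x" "w \<noteq> j" "x \<noteq> j"
    using ns [simplified, rule_format, of 1 0] ns [simplified, rule_format, of 0 1] nj [of 1] by auto
  then have di: "i1 \<noteq> i2" "i1 \<noteq> i3" "i2 \<noteq> i3"
    using i by auto
  have "rows (\<chi> k. f k) = B"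
    using bij_betw_imp_surj_on [OF f] by (auto simp: rows_def row_def vec_lambda_eta)
  then have "invertible (\<chi> k. f k)"
    using spanB by (simp add: invertible_left_inverse matrix_left_invertible_span_rows_gen)
  then have det_nz: "det (\<chi> k. f k) \<noteq> 0"
    by (simp add: invertible_det_nz)
  \<comment> \<open>\<open>cv\<close> regards a vector as a vector of constant polynomials, so that
    the characteristic matrix \<open>N\<close> can act on it.\<close>
  define cv where "cv v = (\<chi> i. [:v $ i:])" for v :: "complex^'n"
  define N where "N = mat [:0, 1:] - map_matrix (\<lambda>a. [:a:]) A"
  define s where "s = [:- l, 1:]"
  have const_sum: "(\<Sum>x\<in>S. [:g x:]) = [:sum g S:]" for g :: "'n \<Rightarrow> complex" and S
    by (induction S rule: infinite_finite_induct) auto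
  \<comment> \<open>The characteristic matrix is the scalar \<open>s\<close> minus the constant
    matrix of \<open>A - l\<close>. The chain relations thereby become the row shapes required by
    \<open>det_triangular_rows\<close>.\<close>
  have Ncv: "N *v cv v = s *s cv v - cv (A *v v - l *s v)" for v
  proof -
    have "mat [:0, 1:] *v cv v = [:0, 1:] *s cv v"
      by (simp add: vec_eq_iff matrix_vector_mult_def mat_def if_distrib [of "\<lambda>a. a * _"] cong: if_cong)
    moreover have "map_matrix (\<lambda>a. [:a:]) A *v cv v = cv (A *v v)"
      by (simp add: vec_eq_iff matrix_vector_mult_def cv_def map_matrix_def const_sum mult.commute)
    ultimately show ?thesis
      by (simp add: N_def matrix_vector_mult_diff_rdistrib)
         (simp add: s_def cv_def vec_eq_iff)
  qed
  have cv_lin: "cv (v + v') = cv v + cv v'" "cv (c *s v) = [:c:] *s cv v" "cv 0 = 0" for v v' c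
    by (simp_all add: cv_def vec_eq_iff)
  have N1: "N *v cv (f i1) = s *s cv x" and N2: "N *v cv (f i2) = s *s cv j - cv x"
    and N3: "N *v cv (f i3) = s *s cv w - [:a:] *s cv x - [:b:] *s cv j"
    by (simp_all add: Ncv i x j w cv_lin add.assoc)
  have "det (\<chi> k. cv (f k)) = [:det (\<chi> k. f k):]"
    using det_hom [of "\<lambda>a. [:a:]" "\<chi> k. f k"] by (simp add: map_matrix_def cv_def one_pCons)
  then have "det (\<chi> k. N *v cv (f k)) = smult (det (\<chi> k. f k)) (charpoly A)"
    using det_rows_mult_vec [of N "\<lambda>k. cv (f k)"] by (simp add: charpoly_def N_def)
  moreover have "s ^ 3 dvd det (\<chi> k. N *v cv (f k))"
    using det_triangular_rows [OF di, of "\<lambda>k. N *v cv (f k)"] N1 N2 N3 by blast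
  ultimately have "s ^ 3 dvd charpoly A"
    using det_nz by (simp add: dvd_smult_iff)
  then have "3 \<le> order l (charpoly A)"
    using charpoly_nonzero by (auto simp: order_divides s_def)
  with am show False
    by (simp add: alg_mult_def)
qed

section \<open>Uniform invertibility on the complement of the chain\<close>

lemma bounded_bilinear_smult: "bounded_bilinear ((*s) :: complex \<Rightarrow> complex^'n \<Rightarrow> complex^'n)"
  by (rule bounded_bilinear.intro)
     (auto simp: vec_eq_iff algebra_simps norm_smult intro!: exI [of _ 1])

text \<open>The Cauchy-Schwarz inequality; taking norms of the entries reduces it to the real
  inequality for \<open>L2_set\<close>.\<close>

lemma norm_hdot_le: "norm (hdot x y) \<le> norm x * norm y"
proof -
  have "norm (hdot x y) \<le> (\<Sum>i\<in>UNIV. \<bar>norm (x $ i)\<bar> * \<bar>norm (y $ i)\<bar>)"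
    unfolding hdot_def by (rule order_trans [OF norm_sum]) (simp add: norm_mult)
  also have "\<dots> \<le> norm x * norm y"
    unfolding norm_vec_def by (rule L2_set_mult_ineq)
  finally show ?thesis .
qed

lemma hdot_smult_left: "hdot (c *s u) v = cnj c * hdot u v"
  by (simp add: hdot_def sum_distrib_left mult.assoc)

lemma hdot_add_left: "hdot (u + v) w = hdot u w + hdot v w"
  by (simp add: hdot_def sum.distrib algebra_simps)

lemma hdot_commute: "hdot u v = cnj (hdot v u)"
  by (simp add: hdot_def mult.commute)

lemma bounded_bilinear_hdot: "bounded_bilinear (hdot :: complex^'n \<Rightarrow> complex^'n \<Rightarrow> complex)"
  using norm_hdot_le
  by (intro bounded_bilinear.intro)
     (auto simp: scaleR_vec_smult hdot_smult_left hdot_smult hdot_add_left hdot_add scaleR_conv_of_real intro!: exI [of _ 1])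

text \<open>\<open>proj_perp\<close> is a projection for unit vectors, hence the scaling of
  \<open>j\<close> by \<open>sgn\<close>. If \<open>x\<close> is a unit vector orthogonal to
  \<open>j\<close>, the product is the orthogonal projection onto the complement of their
  span.\<close>

definition perp_proj :: "complex^'n \<Rightarrow> complex^'n \<Rightarrow> complex^'n^'n" where
  "perp_proj x j = proj_perp x ** proj_perp (sgn j)"

lemma perp_proj_vec:
  assumes "hdot x j = 0"
  shows "perp_proj x j *v v = v - hdot x v *s x - (hdot j v / hdot j j) *s j"
proof -
  have s: "sgn j = of_real (inverse (norm j)) *s j"
    by (simp add: sgn_div_norm scaleR_vec_smult)
  have "hdot (sgn j) v *s sgn j = (hdot j v / hdot j j) *s j"
    by (simp add: s hdot_smult_left hdot_self vector_smult_assoc power2_eq_square field_simps)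
  then show ?thesis
    by (simp add: perp_proj_def matrix_vector_mul_assoc [symmetric] proj_perp_vec
        hdot_diff hdot_smult assms)
qed

lemma perp_proj_decomp:
  assumes "hdot x j = 0"
  shows "v = hdot x v *s x + (hdot j v / hdot j j) *s j + perp_proj x j *v v"
  by (simp add: perp_proj_vec assms)

lemma perp_proj_span:
  assumes "hdot x j = 0" "norm x = 1"
  shows "perp_proj x j *v (p *s x + q *s j) = 0"
proof -
  have "hdot j x = 0"
    using assms(1) by (subst hdot_commute) simp
  then show ?thesis
    using assms by (cases "j = 0") (auto simp: perp_proj_vec hdot_add hdot_smult hdot_self)
qed

text \<open>This is injectivity of \<open>A - l\<close> on the quotient by the span. At
  \<open>l = l0\<close> it is the multiplicity bound; at any other \<open>l\<close> in the disc
  \<open>A - l\<close> is invertible and maps the span onto itself.\<close>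

lemma span_if_mult_in_span:
  assumes "defective2 A l0 x j" and spec: "{l \<in> cball \<mu> r. eigenvalue A l} = {l0}"
    and l: "l \<in> cball \<mu> r" and w: "A *v w - l *s w = p *s x + q *s j"
  shows "\<exists>c d. w = c *s x + d *s j"
proof (cases "l = l0")
  case True
  with assms show ?thesis
    using alg_mult_two_span [of A l0 x j w p q]
    by (auto simp: defective2_def jordan_chain_def algebra_simps)
next
  case False
  have x: "A *v x = l0 *s x" and j: "A *v j = l0 *s j + x"
    using assms(1) by (auto simp: defective2_def jordan_chain_def)
  have neig: "\<not> eigenvalue A l"
    using spec l False by blast
  \<comment> \<open>These solve the triangular system that makes \<open>A - l\<close> send
    \<open>c *s x + d *s j\<close> to \<open>p *s x + q *s j\<close>; the difference from
    \<open>w\<close> then lies in the kernel of \<open>A - l\<close>.\<close>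
  define d c where "d = q / (l0 - l)" and "c = (p - d) / (l0 - l)"
  let ?z = "w - (c *s x + d *s j)"
  have q: "q = (l0 - l) * d" and p: "p = (l0 - l) * c + d"
    using False by (auto simp: d_def c_def)
  have "A *v ?z = A *v w - (c *s (l0 *s x) + d *s (l0 *s j + x))"
    by (simp add: matrix_vector_mult_diff_distrib matrix_vector_right_distrib vector_scalar_commute x j)
  also have "A *v w = l *s w + p *s x + q *s j"
    using w by (simp add: algebra_simps)
  finally have "A *v ?z = l *s ?z"
    unfolding p q by (simp add: vec_eq_iff algebra_simps)
  then have "?z = 0"
    using neig unfolding eigenvalue_def by blast
  then show ?thesis
    by auto
qed

text \<open>Compactness gives the uniform constant: the projected image under \<open>A - l\<close>
  is continuous and nonzero on unit vectors of the complement times the disc, so its norm has a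
  positive minimum \<open>m\<close>, and \<open>K\<close> is \<open>inverse m\<close>.\<close>

lemma norm_perp_proj_le:
  fixes A :: "complex^'n^'n"
  assumes def2: "defective2 A l0 x j" and nc: "normalized_chain x j"
    and spec: "{l \<in> cball \<mu> r. eigenvalue A l} = {l0}"
  shows "\<exists>K. \<forall>l\<in>cball \<mu> r. \<forall>u.
    norm (perp_proj x j *v u) \<le> K * norm (perp_proj x j *v (A *v u - l *s u))"
proof -
  let ?Q = "perp_proj x j"
  have nx: "norm x = 1" and xj: "hdot x j = 0"
    using nc by (auto simp: normalized_chain_def)
  have x: "A *v x = l0 *s x" and j: "A *v j = l0 *s j + x"
    using def2 by (auto simp: defective2_def jordan_chain_def)
  have QQ: "?Q *v (?Q *v v) = ?Q *v v" for v
  proof -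
    have "?Q *v v = v - (hdot x v *s x + (hdot j v / hdot j j) *s j)"
      by (simp add: perp_proj_vec xj)
    then show ?thesis
      by (metis matrix_vector_mult_diff_distrib perp_proj_span [OF xj nx] diff_zero)
  qed
  \<comment> \<open>The span of the chain is invariant under \<open>A - l\<close>, so the part of
    \<open>u\<close> inside it disappears after projection.\<close>
  have QA: "?Q *v (A *v u - l *s u) = ?Q *v (A *v (?Q *v u) - l *s (?Q *v u))" for l u
  proof -
    define p q where "p = hdot x u" and "q = hdot j u / hdot j j"
    have u: "u = p *s x + q *s j + ?Q *v u"
      unfolding p_def q_def by (rule perp_proj_decomp [OF xj])
    have "A *v u = A *v (p *s x + q *s j) + A *v (?Q *v u)"
      by (metis u matrix_vector_right_distrib)
    moreover have "l *s u = l *s (p *s x + q *s j) + l *s (?Q *v u)"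
      by (metis u vector_add_ldistrib)
    moreover have "A *v (p *s x + q *s j) = (p * l0 + q) *s x + (q * l0) *s j"
      by (simp add: matrix_vector_right_distrib vector_scalar_commute x j vec_eq_iff algebra_simps)
    ultimately have "A *v u - l *s u =
        (A *v (?Q *v u) - l *s (?Q *v u)) + ((p * l0 + q - l * p) *s x + (q * l0 - l * q) *s j)"
      by (simp add: vec_eq_iff algebra_simps)
    then show ?thesis
      by (metis matrix_vector_right_distrib perp_proj_span [OF xj nx] add_0_right)
  qed
  define W where "W = {w. ?Q *v w = w} \<inter> sphere 0 1"
  define f where "f = (\<lambda>(w, l). norm (?Q *v (A *v w - l *s w)))"
  have cont_mult: "continuous_on S (\<lambda>p. M *v g p)" if "continuous_on S g"
    for M :: "complex^'n^'n" and S :: "((complex^'n) \<times> complex) set" and g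
    using bounded_linear.continuous_on [OF matrix_vector_mul_bounded_linear that] .
  have "closed {w. ?Q *v w = w}"
    by (intro closed_Collect_eq bounded_linear.continuous_on [OF matrix_vector_mul_bounded_linear] continuous_intros)
  then have "compact (W \<times> cball \<mu> r)"
    unfolding W_def by (intro compact_Times closed_Int_compact) auto
  moreover have "continuous_on (W \<times> cball \<mu> r) f"
    unfolding f_def case_prod_beta
    by (intro continuous_intros cont_mult bounded_bilinear.continuous_on [OF bounded_bilinear_smult])
  ultimately have min: "W \<times> cball \<mu> r \<noteq> {} \<Longrightarrow> \<exists>p\<in>W \<times> cball \<mu> r. \<forall>q\<in>W \<times> cball \<mu> r. f p \<le> f q"
    by (intro continuous_attains_inf)
  have pos: "f p > 0" if "p \<in> W \<times> cball \<mu> r" for p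
  proof -
    obtain w l where p: "p = (w, l)"
      by fastforce
    with that have w: "?Q *v w = w" "norm w = 1" and l: "l \<in> cball \<mu> r"
      by (auto simp: W_def)
    have "?Q *v (A *v w - l *s w) \<noteq> 0"
    proof
      assume 0: "?Q *v (A *v w - l *s w) = 0"
      obtain c d where "w = c *s x + d *s j"
        using span_if_mult_in_span [OF def2 spec l] perp_proj_decomp [OF xj, of "A *v w - l *s w"]
        unfolding 0 add_0_right by blast
      with w show False
        using perp_proj_span [OF xj nx, of c d] by simp
    qed
    then show ?thesis
      by (simp add: f_def p)
  qed
  \<comment> \<open>\<open>W\<close> is empty when the chain spans the whole space; there is then
    nothing to minimize and the value 1 serves.\<close>
  obtain m where m: "m > 0" "\<And>q. q \<in> W \<times> cball \<mu> r \<Longrightarrow> m \<le> f q"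
  proof (cases "W \<times> cball \<mu> r = {}")
    case False
    then show ?thesis
      using min pos that by metis
  qed (use that [of 1] in auto)
  show ?thesis
  proof (intro exI [of _ "inverse m"] ballI allI)
    fix l u assume l: "l \<in> cball \<mu> r"
    let ?y = "?Q *v u"
    show "norm ?y \<le> inverse m * norm (?Q *v (A *v u - l *s u))"
    proof (cases "?y = 0")
      case False
      define c where "c = complex_of_real (inverse (norm ?y))"
      have c: "norm c = inverse (norm ?y)"
        by (simp add: c_def norm_inverse)
      have "c *s ?y \<in> W"
        using False by (simp add: W_def vector_scalar_commute QQ norm_smult c)
      then have "m \<le> f (c *s ?y, l)"
        using l by (intro m) auto
      also have "f (c *s ?y, l) = inverse (norm ?y) * norm (?Q *v (A *v ?y - l *s ?y))"
      proof -
        have "A *v (c *s ?y) - l *s (c *s ?y) = c *s (A *v ?y - l *s ?y)"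
          by (simp add: vector_scalar_commute vec_eq_iff algebra_simps)
        then have "f (c *s ?y, l) = norm (?Q *v (c *s (A *v ?y - l *s ?y)))"
          by (simp only: f_def case_prod_conv)
        then show ?thesis
          by (simp only: vector_scalar_commute norm_smult c)
      qed
      finally show ?thesis
        using False m(1) by (simp add: QA [of u] field_simps)
    qed (use m in simp)
  qed
qed

section \<open>Asymptotics of vector-valued functions\<close>

text \<open>Passing to the norm lets scalars, vectors and reals share one calculus of
  estimates.\<close>

definition vec_bigo :: "(real \<Rightarrow> 'a::real_normed_vector) \<Rightarrow> (real \<Rightarrow> real) \<Rightarrow> bool" where
  "vec_bigo f g \<longleftrightarrow> (\<lambda>\<epsilon>. norm (f \<epsilon>)) \<in> O[at_right 0](g)"

abbreviation small :: "(real \<Rightarrow> 'a::real_normed_vector) \<Rightarrow> bool" where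
  "small f \<equiv> vec_bigo f (\<lambda>\<epsilon>. \<epsilon>)"

abbreviation bdd :: "(real \<Rightarrow> 'a::real_normed_vector) \<Rightarrow> bool" where
  "bdd f \<equiv> vec_bigo f (\<lambda>\<epsilon>. 1)"

lemma vec_bigo_mono:
  assumes "vec_bigo f g" and "\<forall>\<^sub>F \<epsilon> in at_right 0. norm (h \<epsilon>) \<le> C * norm (f \<epsilon>)"
  shows "vec_bigo h g"
proof -
  have "(\<lambda>\<epsilon>. norm (h \<epsilon>)) \<in> O[at_right 0](\<lambda>\<epsilon>. norm (f \<epsilon>))"
    using assms(2) by (intro bigoI [of _ C]) simp
  then show ?thesis
    using assms(1) unfolding vec_bigo_def by (rule landau_o.big_trans)
qed

lemma vec_bigo_cong:
  assumes "vec_bigo f g" and "\<forall>\<^sub>F \<epsilon> in at_right 0. f \<epsilon> = h \<epsilon>"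
  shows "vec_bigo h g"
  using assms(2) by (intro vec_bigo_mono [OF assms(1), of h 1]) (auto elim!: eventually_mono)

lemma vec_bigo_eq:
  assumes "vec_bigo f g" and "\<And>\<epsilon>. h \<epsilon> = f \<epsilon>"
  shows "vec_bigo h g"
  using assms by (metis ext)

lemma vec_bigo_add:
  assumes "vec_bigo f g" "vec_bigo h g"
  shows "vec_bigo (\<lambda>\<epsilon>. f \<epsilon> + h \<epsilon>) g"
proof -
  have "(\<lambda>\<epsilon>. norm (f \<epsilon>) + norm (h \<epsilon>)) \<in> O[at_right 0](g)"
    using assms unfolding vec_bigo_def by (rule sum_in_bigo)
  then have "vec_bigo (\<lambda>\<epsilon>. norm (f \<epsilon>) + norm (h \<epsilon>)) g"
    unfolding vec_bigo_def by simp
  then show ?thesis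
    by (rule vec_bigo_mono [where C = 1]) (simp add: norm_triangle_ineq)
qed

lemma vec_bigo_minus: "vec_bigo f g \<Longrightarrow> vec_bigo (\<lambda>\<epsilon>. - f \<epsilon>) g"
  by (simp add: vec_bigo_def)

lemma vec_bigo_diff: "vec_bigo f g \<Longrightarrow> vec_bigo h g \<Longrightarrow> vec_bigo (\<lambda>\<epsilon>. f \<epsilon> - h \<epsilon>) g"
  using vec_bigo_add [of f g "\<lambda>\<epsilon>. - h \<epsilon>"] by (simp add: vec_bigo_minus)

lemma vec_bigo_cnj: "vec_bigo f g \<Longrightarrow> vec_bigo (\<lambda>\<epsilon>. cnj (f \<epsilon>)) g"
  by (simp add: vec_bigo_def)

text \<open>The common source of the product rules for multiplication, scaling and
  \<open>hdot\<close> stated further down.\<close>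

lemma vec_bigo_bilinear:
  assumes "bounded_bilinear B" and "vec_bigo f g" "vec_bigo k h"
  shows "vec_bigo (\<lambda>\<epsilon>. B (f \<epsilon>) (k \<epsilon>)) (\<lambda>\<epsilon>. g \<epsilon> * h \<epsilon>)"
proof -
  obtain C where C: "\<And>a b. norm (B a b) \<le> norm a * norm b * C"
    using bounded_bilinear.bounded [OF assms(1)] by blast
  have "vec_bigo (\<lambda>\<epsilon>. norm (f \<epsilon>) * norm (k \<epsilon>)) (\<lambda>\<epsilon>. g \<epsilon> * h \<epsilon>)"
    using landau_o.big.mult [OF assms(2,3) [unfolded vec_bigo_def]]
    by (simp add: vec_bigo_def)
  then show ?thesis
    by (rule vec_bigo_mono [where C = C]) (use C in \<open>simp add: mult.commute\<close>)
qed

lemma vec_bigo_linear: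
  assumes "bounded_linear L" and "vec_bigo f g"
  shows "vec_bigo (\<lambda>\<epsilon>. L (f \<epsilon>)) g"
proof -
  obtain C where "\<And>a. norm (L a) \<le> norm a * C"
    using bounded_linear.bounded [OF assms(1)] by blast
  then show ?thesis
    by (intro vec_bigo_mono [OF assms(2), where C = C]) (simp add: mult.commute)
qed

lemma vec_bigo_matrix: "vec_bigo f g \<Longrightarrow> vec_bigo (\<lambda>\<epsilon>. M *v f \<epsilon>) g"
  for f :: "real \<Rightarrow> complex^'n" and M :: "complex^'n^'m"
  by (rule vec_bigo_linear [OF matrix_vector_mul_bounded_linear])

lemma bdd_iff: "bdd f \<longleftrightarrow> Bfun f (at_right 0)"
proof
  assume "bdd f"
  then obtain c where "c > 0" "\<forall>\<^sub>F \<epsilon> in at_right 0. norm (f \<epsilon>) \<le> c"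
    unfolding vec_bigo_def by (elim landau_o.bigE) simp
  then show "Bfun f (at_right 0)"
    by (intro BfunI)
next
  assume "Bfun f (at_right 0)"
  then obtain c where "c > 0" "\<forall>\<^sub>F \<epsilon> in at_right 0. norm (f \<epsilon>) \<le> c"
    by (rule BfunE)
  then show "bdd f"
    unfolding vec_bigo_def by (intro bigoI [of _ c]) simp
qed

lemma bddI: "\<forall>\<^sub>F \<epsilon> in at_right 0. norm (f \<epsilon>) \<le> C \<Longrightarrow> bdd f"
  unfolding bdd_iff by (rule BfunI)

lemma bdd_const: "bdd (\<lambda>\<epsilon>. c)"
  by (rule bddI [of _ "norm c"]) simp

lemma small_tendsto_0:
  assumes "small f"
  shows "(f \<longlongrightarrow> 0) (at_right 0)"
proof -
  obtain c where c: "c > 0" "\<forall>\<^sub>F \<epsilon> in at_right 0. norm (f \<epsilon>) \<le> c * \<bar>\<epsilon>\<bar>"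
    using assms unfolding vec_bigo_def by (elim landau_o.bigE) simp
  have "((\<lambda>\<epsilon>::real. c * \<bar>\<epsilon>\<bar>) \<longlongrightarrow> c * \<bar>0\<bar>) (at_right 0)"
    by (intro tendsto_intros)
  then show ?thesis
    using c(2) by (intro Lim_null_comparison [of f "\<lambda>\<epsilon>. c * \<bar>\<epsilon>\<bar>"]) auto
qed

lemma tendsto_bdd: "(f \<longlongrightarrow> a) (at_right 0) \<Longrightarrow> bdd f"
proof (rule bddI [of _ "norm a + 1"])
  assume "(f \<longlongrightarrow> a) (at_right 0)"
  then have "((\<lambda>\<epsilon>. norm (f \<epsilon>)) \<longlongrightarrow> norm a) (at_right 0)"
    by (rule tendsto_norm)
  then have "\<forall>\<^sub>F \<epsilon> in at_right 0. norm (f \<epsilon>) < norm a + 1"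
    by (rule order_tendstoD) simp
  then show "\<forall>\<^sub>F \<epsilon> in at_right 0. norm (f \<epsilon>) \<le> norm a + 1"
    by (rule eventually_mono) simp
qed

lemma small_imp_bdd: "small f \<Longrightarrow> bdd f"
  by (rule tendsto_bdd [OF small_tendsto_0])

lemma bdd_mult: "bdd f \<Longrightarrow> bdd g \<Longrightarrow> bdd (\<lambda>\<epsilon>. f \<epsilon> * g \<epsilon>)" for f :: "real \<Rightarrow> complex"
  using vec_bigo_bilinear [OF bounded_bilinear_mult, of f _ g] by fastforce

lemma bdd_smult: "bdd f \<Longrightarrow> bdd g \<Longrightarrow> bdd (\<lambda>\<epsilon>. f \<epsilon> *s g \<epsilon>)" for g :: "real \<Rightarrow> complex^'n"
  using vec_bigo_bilinear [OF bounded_bilinear_smult, of f _ g] by fastforce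

lemma bdd_hdot: "bdd f \<Longrightarrow> bdd g \<Longrightarrow> bdd (\<lambda>\<epsilon>. hdot (f \<epsilon>) (g \<epsilon>))"
  using vec_bigo_bilinear [OF bounded_bilinear_hdot, of f _ g] by fastforce

lemma small_mult: "bdd f \<Longrightarrow> small g \<Longrightarrow> small (\<lambda>\<epsilon>. f \<epsilon> * g \<epsilon>)" for f :: "real \<Rightarrow> complex"
  using vec_bigo_bilinear [OF bounded_bilinear_mult, of f _ g] by fastforce

lemma small_smult: "bdd f \<Longrightarrow> small g \<Longrightarrow> small (\<lambda>\<epsilon>. f \<epsilon> *s g \<epsilon>)" for g :: "real \<Rightarrow> complex^'n"
  using vec_bigo_bilinear [OF bounded_bilinear_smult, of f _ g] by fastforce

lemma small_smult_left: "small f \<Longrightarrow> bdd g \<Longrightarrow> small (\<lambda>\<epsilon>. f \<epsilon> *s g \<epsilon>)" for g :: "real \<Rightarrow> complex^'n"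
  using vec_bigo_bilinear [OF bounded_bilinear_smult, of f _ g] by fastforce

lemma small_hdot: "bdd f \<Longrightarrow> small g \<Longrightarrow> small (\<lambda>\<epsilon>. hdot (f \<epsilon>) (g \<epsilon>))"
  using vec_bigo_bilinear [OF bounded_bilinear_hdot, of f _ g] by fastforce

lemma small_hdot_left: "small f \<Longrightarrow> bdd g \<Longrightarrow> small (\<lambda>\<epsilon>. hdot (f \<epsilon>) (g \<epsilon>))"
  using vec_bigo_bilinear [OF bounded_bilinear_hdot, of f _ g] by fastforce

lemmas bdd_intros = bdd_const vec_bigo_add vec_bigo_minus vec_bigo_diff vec_bigo_cnj vec_bigo_matrix
  bdd_mult bdd_smult bdd_hdot

text \<open>The means of keeping quantities away from zero: when a product tends to one, each of its
  factors is eventually nonzero, and bounds on the other factors bound the inverse.\<close>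

lemma tendsto_1_inverse:
  fixes f :: "real \<Rightarrow> complex"
  assumes "(f \<longlongrightarrow> 1) (at_right 0)"
  shows "bdd (\<lambda>\<epsilon>. inverse (f \<epsilon>))" and "\<forall>\<^sub>F \<epsilon> in at_right 0. f \<epsilon> \<noteq> 0"
proof -
  show "bdd (\<lambda>\<epsilon>. inverse (f \<epsilon>))"
    using tendsto_inverse [OF assms] by (intro tendsto_bdd) auto
  show "\<forall>\<^sub>F \<epsilon> in at_right 0. f \<epsilon> \<noteq> 0"
    using tendsto_imp_eventually_ne [OF assms] by simp
qed

text \<open>Serves for the coordinate \<open>b1\<close> in the main proof, of which only the square
  is known to be \<open>small\<close>.\<close>

lemma bdd_mult_tendsto_0:
  fixes f :: "real \<Rightarrow> complex"
  assumes "bdd f" "(g \<longlongrightarrow> 0) (at_right 0)"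
  shows "((\<lambda>\<epsilon>. f \<epsilon> * g \<epsilon>) \<longlongrightarrow> 0) (at_right 0)"
  using assms unfolding bdd_iff tendsto_Zfun_iff
  by (auto intro: bounded_bilinear.Bfun_prod_Zfun [OF bounded_bilinear_mult])

lemma tendsto_0_if_square:
  fixes f :: "real \<Rightarrow> complex"
  assumes "((\<lambda>\<epsilon>. f \<epsilon> * f \<epsilon>) \<longlongrightarrow> 0) F"
  shows "(f \<longlongrightarrow> 0) F"
proof -
  have "((\<lambda>\<epsilon>. sqrt (norm (f \<epsilon> * f \<epsilon>))) \<longlongrightarrow> sqrt (norm (0 :: complex))) F"
    by (intro tendsto_intros assms)
  then show ?thesis
    by (simp add: norm_mult tendsto_norm_zero_iff)
qed

text \<open>The same factor \<beta> in front of \<open>x0\<close> and \<open>j0\<close> is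
  essential: normalization divides both by nearly its modulus, and making \<open>j\<close>
  orthogonal to \<open>x\<close> removes the \<alpha> term, so that only the common phase
  \<open>sgn \<beta>\<close> remains. The lower bound on \<open>x\<close> keeps \<beta> away from
  zero.\<close>

lemma normalize_chain_perturbation:
  fixes x j :: "real \<Rightarrow> complex^'n" and \<alpha> \<beta> :: "real \<Rightarrow> complex"
  assumes nc: "normalized_chain x0 j0"
    and x: "small (\<lambda>\<epsilon>. x \<epsilon> - \<beta> \<epsilon> *s x0)"
    and j: "small (\<lambda>\<epsilon>. j \<epsilon> - (\<alpha> \<epsilon> *s x0 + \<beta> \<epsilon> *s j0))"
    and bd: "bdd \<alpha>" "bdd \<beta>"
    and nx: "\<forall>\<^sub>F \<epsilon> in at_right 0. 1 \<le> norm (x \<epsilon>)"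
  shows "small (\<lambda>\<epsilon>. sgn (\<beta> \<epsilon>) *s x0 - fst (normalize_chain (x \<epsilon>, j \<epsilon>)))" (is ?A)
    and "small (\<lambda>\<epsilon>. sgn (\<beta> \<epsilon>) *s j0 - snd (normalize_chain (x \<epsilon>, j \<epsilon>)))" (is ?B)
    and "\<forall>\<^sub>F \<epsilon> in at_right 0. \<beta> \<epsilon> \<noteq> 0" (is ?C)
proof -
  have x0: "norm x0 = 1" and xj0: "hdot x0 j0 = 0"
    using nc by (auto simp: normalized_chain_def)
  define ex where "ex \<epsilon> = x \<epsilon> - \<beta> \<epsilon> *s x0" for \<epsilon>
  define ej where "ej \<epsilon> = j \<epsilon> - (\<alpha> \<epsilon> *s x0 + \<beta> \<epsilon> *s j0)" for \<epsilon>
  define ix where "ix \<epsilon> = complex_of_real (1 / norm (x \<epsilon>))" for \<epsilon>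
  define ib where "ib \<epsilon> = complex_of_real (1 / norm (\<beta> \<epsilon>))" for \<epsilon>
  have ex: "small ex" and ej: "small ej"
    unfolding ex_def ej_def by (rule x j)+
  have x_eq: "x \<epsilon> = \<beta> \<epsilon> *s x0 + ex \<epsilon>" for \<epsilon>
    by (simp add: ex_def)
  have bx: "bdd x"
    unfolding x_eq [abs_def] by (intro bdd_intros bd small_imp_bdd [OF ex])
  have norm_diff: "\<bar>norm (\<beta> \<epsilon>) - norm (x \<epsilon>)\<bar> \<le> norm (ex \<epsilon>)" for \<epsilon>
    using norm_triangle_ineq3 [of "\<beta> \<epsilon> *s x0" "x \<epsilon>"]
    by (simp add: norm_smult x0 ex_def norm_minus_commute)
  have "\<forall>\<^sub>F \<epsilon> in at_right 0. norm (ex \<epsilon>) < 1 / 2"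
    by (rule order_tendstoD(2) [OF tendsto_norm_zero [OF small_tendsto_0 [OF ex]]]) simp
  with nx have nb: "\<forall>\<^sub>F \<epsilon> in at_right 0. 1 / 2 \<le> norm (\<beta> \<epsilon>)"
  proof eventually_elim
    case (elim \<epsilon>)
    then show ?case
      using norm_diff [of \<epsilon>] by linarith
  qed
  then show ?C
    by eventually_elim auto
  have bix: "bdd ix"
    using nx by (intro bddI [of _ 1]) (auto simp: ix_def norm_divide divide_simps elim!: eventually_mono)
  have bib: "bdd ib"
    using nb by (intro bddI [of _ 2])
      (auto simp: ib_def norm_divide elim!: eventually_mono, simp add: divide_simps)
  have "bdd (\<lambda>\<epsilon>. inverse (\<beta> \<epsilon>))"
    using nb by (intro bddI [of _ 2])
      (auto simp: norm_inverse elim!: eventually_mono, simp add: divide_simps)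
  then have bk: "bdd (\<lambda>\<epsilon>. \<alpha> \<epsilon> * inverse (\<beta> \<epsilon>))"
    by (intro bdd_intros bd)
  have "bdd (\<lambda>\<epsilon>. ix \<epsilon> * ix \<epsilon>)"
    by (intro bdd_intros bix)
  then have bixx: "bdd (\<lambda>\<epsilon>. inverse (hdot (x \<epsilon>) (x \<epsilon>)))"
    by (rule vec_bigo_eq) (simp add: hdot_self ix_def power2_eq_square inverse_eq_divide)
  have "small (\<lambda>\<epsilon>. complex_of_real (norm (\<beta> \<epsilon>) - norm (x \<epsilon>)))"
    using norm_diff by (intro vec_bigo_mono [OF ex, where C = 1]) (simp del: of_real_diff)
  then have "small (\<lambda>\<epsilon>. ib \<epsilon> * ix \<epsilon> * complex_of_real (norm (\<beta> \<epsilon>) - norm (x \<epsilon>)))"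
    by (intro small_mult bdd_intros bib bix)
  then have D: "small (\<lambda>\<epsilon>. ix \<epsilon> - ib \<epsilon>)"
  proof (rule vec_bigo_cong)
    show "\<forall>\<^sub>F \<epsilon> in at_right 0. ib \<epsilon> * ix \<epsilon> * complex_of_real (norm (\<beta> \<epsilon>) - norm (x \<epsilon>)) = ix \<epsilon> - ib \<epsilon>"
      using nb nx
    proof eventually_elim
      case (elim \<epsilon>)
      then have "norm (\<beta> \<epsilon>) \<noteq> 0" "norm (x \<epsilon>) \<noteq> 0"
        by auto
      then show ?case
        by (simp add: ib_def ix_def field_simps)
    qed
  qed
  have sgn_eq: "sgn (\<beta> \<epsilon>) = \<beta> \<epsilon> * ib \<epsilon>" for \<epsilon>
    by (simp add: ib_def sgn_div_norm scaleR_conv_of_real field_simps)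
  have "small (\<lambda>\<epsilon>. - (ix \<epsilon> *s ex \<epsilon>) - (\<beta> \<epsilon> * (ix \<epsilon> - ib \<epsilon>)) *s x0)"
    by (intro vec_bigo_diff vec_bigo_minus small_smult bix ex small_smult_left small_mult bd D bdd_const)
  then show ?A
    by (rule vec_bigo_eq)
      (simp add: normalize_chain_def sgn_eq scaleR_vec_smult ex_def, simp add: ix_def vec_eq_iff algebra_simps)
  \<comment> \<open>With \<open>k = \<alpha> / \<beta>\<close> one has
    \<open>j = k *s x + \<beta> *s j0 + g\<close>, and \<open>h\<close> is what remains of
    \<open>hdot x j\<close> after \<open>k * hdot x x\<close>. It is small because \<open>j0\<close>
    is orthogonal to \<open>x0\<close>, hence nearly so to \<open>x\<close>. The projection
    therefore removes \<open>k *s x\<close> and a small multiple of \<open>x\<close>.\<close>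
  define g where "g \<epsilon> = ej \<epsilon> - (\<alpha> \<epsilon> * inverse (\<beta> \<epsilon>)) *s ex \<epsilon>" for \<epsilon>
  define h where "h \<epsilon> = \<beta> \<epsilon> * hdot (ex \<epsilon>) j0 + hdot (x \<epsilon>) (g \<epsilon>)" for \<epsilon>
  have g: "small g"
    unfolding g_def by (intro vec_bigo_diff ej small_smult bk ex)
  have h: "small h"
    unfolding h_def by (intro vec_bigo_add small_mult bd small_hdot_left ex bdd_const small_hdot bx g)
  have "small (\<lambda>\<epsilon>. - ((\<beta> \<epsilon> * (ix \<epsilon> - ib \<epsilon>)) *s j0) -
      ix \<epsilon> *s (g \<epsilon> - (inverse (hdot (x \<epsilon>) (x \<epsilon>)) * h \<epsilon>) *s x \<epsilon>))" (is "small ?f")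
    by (intro vec_bigo_diff vec_bigo_minus small_smult bix small_smult_left small_mult bd D bdd_const
        g h bixx bx)
  then show ?B
  proof (rule vec_bigo_cong)
    show "\<forall>\<^sub>F \<epsilon> in at_right 0. ?f \<epsilon> = sgn (\<beta> \<epsilon>) *s j0 - snd (normalize_chain (x \<epsilon>, j \<epsilon>))"
      using nb nx
    proof eventually_elim
      case (elim \<epsilon>)
      then have b0: "\<beta> \<epsilon> \<noteq> 0" and xx: "hdot (x \<epsilon>) (x \<epsilon>) \<noteq> 0"
        by (auto simp: hdot_self)
      define k where "k = \<alpha> \<epsilon> * inverse (\<beta> \<epsilon>)"
      have "k * \<beta> \<epsilon> = \<alpha> \<epsilon>"
        using b0 by (simp add: k_def)
      then have j_eq: "j \<epsilon> = k *s x \<epsilon> + \<beta> \<epsilon> *s j0 + g \<epsilon>"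
        unfolding g_def ej_def k_def [symmetric] x_eq [of \<epsilon>]
        by (auto simp: vec_eq_iff algebra_simps)
      have "hdot (x \<epsilon>) j0 = hdot (ex \<epsilon>) j0"
        by (simp add: x_eq [of \<epsilon>] hdot_add_left hdot_smult_left xj0)
      then have hh: "hdot (x \<epsilon>) (j \<epsilon>) = k * hdot (x \<epsilon>) (x \<epsilon>) + h \<epsilon>"
        by (simp add: j_eq h_def hdot_add hdot_smult)
      have "hdot (x \<epsilon>) (j \<epsilon>) / hdot (x \<epsilon>) (x \<epsilon>) = k + inverse (hdot (x \<epsilon>) (x \<epsilon>)) * h \<epsilon>"
        using xx unfolding hh by (simp add: field_simps)
      then have "snd (normalize_chain (x \<epsilon>, j \<epsilon>)) =
          ix \<epsilon> *s (j \<epsilon> - (k + inverse (hdot (x \<epsilon>) (x \<epsilon>)) * h \<epsilon>) *s x \<epsilon>)"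
        by (simp only: normalize_chain_def scaleR_vec_smult ix_def case_prod_conv snd_conv)
      then show ?case
        unfolding j_eq sgn_eq by (simp add: vec_eq_iff algebra_simps)
    qed
  qed
qed

section \<open>Perturbation of the Jordan chain\<close>

lemma schur_block_nth:
  "schur_block A u1 u2 $ 1 $ 1 = hdot u1 (A *v u1)"
  "schur_block A u1 u2 $ 1 $ 2 = hdot u1 (A *v u2)"
  "schur_block A u1 u2 $ 2 $ 2 = hdot u2 (A *v u2)"
proof -
  have "schur_block A u1 u2 $ i $ k =
      hdot (if i = 1 then u1 else u2) (A *v (if k = 1 then u1 else u2))" for i k :: 2
    unfolding schur_block_def matrix_mul_assoc [symmetric]
    by (simp add: matrix_matrix_mult_def matrix_vector_mult_def hdot_def ctranspose_def transpose_def
        map_matrix_def basis_mat_def)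
  from this [of 1 1] this [of 1 2] this [of 2 2] show
    "schur_block A u1 u2 $ 1 $ 1 = hdot u1 (A *v u1)"
    "schur_block A u1 u2 $ 1 $ 2 = hdot u1 (A *v u2)"
    "schur_block A u1 u2 $ 2 $ 2 = hdot u2 (A *v u2)"
    by simp_all
qed

text \<open>Pairing with \<open>x\<close> and with \<open>j\<close>, which are orthogonal and
  nonzero, extracts the two coordinates.\<close>

lemma small_coords:
  assumes nc: "normalized_chain x j" and "j \<noteq> 0" and s: "small (\<lambda>\<epsilon>. p \<epsilon> *s x + q \<epsilon> *s j)"
  shows "small p" "small q"
proof -
  have h: "hdot x x = 1" "hdot x j = 0" "hdot j x = 0" "hdot j j \<noteq> 0"
    using nc \<open>j \<noteq> 0\<close> hdot_commute [of j x] by (auto simp: normalized_chain_def hdot_self)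
  have "small (\<lambda>\<epsilon>. hdot x (p \<epsilon> *s x + q \<epsilon> *s j))"
    by (intro small_hdot bdd_const s)
  then show "small p"
    by (simp add: hdot_add hdot_smult h)
  have "small (\<lambda>\<epsilon>. inverse (hdot j j) * hdot j (p \<epsilon> *s x + q \<epsilon> *s j))"
    by (intro small_mult small_hdot bdd_const s)
  then show "small q"
    by (rule vec_bigo_eq) (simp add: hdot_add hdot_smult h)
qed

theorem theorem1:
  fixes A0 :: "complex^'n^'n" and A :: "real \<Rightarrow> complex^'n^'n"
    and x0 j0 :: "complex^'n" and l0 \<mu> :: complex and r :: real
    and tol :: "real \<Rightarrow> real" and u1 u2 :: "real \<Rightarrow> complex^'n"
  assumes "defective2 A0 l0 x0 j0" and "normalized_chain x0 j0"
    and "(\<lambda>\<epsilon>. onorm ((*v) (A \<epsilon> - A0))) \<in> O[at_right 0](\<lambda>\<epsilon>. \<epsilon>)"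
    and "{l \<in> cball \<mu> r. eigenvalue A0 l} = {l0}"
    and "tol \<in> O[at_right 0](\<lambda>\<epsilon>. \<epsilon>)"
    and "\<forall>\<^sub>F \<epsilon> in at_right 0. invariant_basis (A \<epsilon>) \<mu> r (tol \<epsilon>) (u1 \<epsilon>) (u2 \<epsilon>)"
  shows "\<exists>c :: real \<Rightarrow> complex. (\<forall>\<epsilon>. norm (c \<epsilon>) = 1) \<and>
    (\<lambda>\<epsilon>. norm (c \<epsilon> *s x0 - approx_x (A \<epsilon>) (u1 \<epsilon>) (u2 \<epsilon>))) \<in> O[at_right 0](\<lambda>\<epsilon>. \<epsilon>) \<and>
    (\<lambda>\<epsilon>. norm (c \<epsilon> *s j0 - approx_j (A \<epsilon>) (u1 \<epsilon>) (u2 \<epsilon>))) \<in> O[at_right 0](\<lambda>\<epsilon>. \<epsilon>)"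
proof -
  let ?F = "at_right (0::real)"
  let ?Q = "perp_proj x0 j0"
  let ?S = "\<lambda>\<epsilon>. schur_block (A \<epsilon>) (u1 \<epsilon>) (u2 \<epsilon>)"
  define J where "J = hdot j0 j0"
  have x0: "norm x0 = 1" and xj0: "hdot x0 j0 = 0"
    using assms(2) by (auto simp: normalized_chain_def)
  have Ax0: "A0 *v x0 = l0 *s x0" and Aj0: "A0 *v j0 = l0 *s j0 + x0"
    using assms(1) by (auto simp: defective2_def jordan_chain_def)
  have j0: "j0 \<noteq> 0"
    using Aj0 x0 by auto
  have J0: "J \<noteq> 0" and cnjJ: "cnj J = J"
    using j0 by (auto simp: J_def hdot_self)
  have dots: "hdot x0 x0 = 1" "hdot j0 x0 = 0" "hdot j0 j0 = J"
    using hdot_commute [of j0 x0] by (auto simp: hdot_self x0 xj0 J_def)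
  let ?P = "\<lambda>\<epsilon> m1 m2. m1 \<in> cball \<mu> r \<and> norm (u1 \<epsilon>) = 1 \<and> A \<epsilon> *v u1 \<epsilon> = m1 *s u1 \<epsilon> \<and>
      m2 \<in> cball \<mu> r \<and> norm (u2 \<epsilon>) = 1 \<and> hdot (u1 \<epsilon>) (u2 \<epsilon>) = 0 \<and>
      norm ((proj_perp (u1 \<epsilon>) ** A \<epsilon> - mat m2) *v u2 \<epsilon>) \<le> tol \<epsilon>"
  have "\<forall>\<^sub>F \<epsilon> in ?F. \<exists>m1 m2. ?P \<epsilon> m1 m2"
    using assms(6) by (rule eventually_mono) (unfold invariant_basis_def, blast)
  then obtain l1 l2 where basis: "\<forall>\<^sub>F \<epsilon> in ?F. ?P \<epsilon> (l1 \<epsilon>) (l2 \<epsilon>)"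
    unfolding eventually_ex by (elim exE)

  \<comment> \<open>Residuals of the computed basis\<close>
  define s where "s \<epsilon> = hdot (u1 \<epsilon>) (A \<epsilon> *v u2 \<epsilon>)" for \<epsilon>
  define res where "res \<epsilon> = (proj_perp (u1 \<epsilon>) ** A \<epsilon> - mat (l2 \<epsilon>)) *v u2 \<epsilon>" for \<epsilon>
  \<comment> \<open>The projection subtracts from \<open>A u2\<close> exactly its component
    \<open>s\<close> along \<open>u1\<close>, so the vector in the stopping test is the defect of
    the second Schur relation.\<close>
  have res_eq: "A \<epsilon> *v u2 \<epsilon> = s \<epsilon> *s u1 \<epsilon> + l2 \<epsilon> *s u2 \<epsilon> + res \<epsilon>" for \<epsilon>
    by (simp add: res_def s_def matrix_vector_mult_diff_rdistrib mat_mult_vec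
        matrix_vector_mul_assoc [symmetric] proj_perp_vec)
  have "small tol"
    using assms(5) by (simp add: vec_bigo_def)
  then have res: "small res"
    by (rule vec_bigo_mono [where C = 1])
      (use basis in \<open>auto simp: res_def elim!: eventually_mono\<close>)
  have bu: "bdd u1" "bdd u2" and bl: "bdd l1" "bdd l2"
  proof -
    show "bdd u1" "bdd u2"
      using basis by (auto intro!: bddI [of _ 1] elim!: eventually_mono)
    have "norm l \<le> norm \<mu> + r" if "l \<in> cball \<mu> r" for l
      using that norm_triangle_ineq3 [of l \<mu>] by (simp add: dist_norm norm_minus_commute)
    then show "bdd l1" "bdd l2"
      using basis by (auto intro!: bddI [of _ "norm \<mu> + r"] elim!: eventually_mono)
  qed
  have pert: "small (\<lambda>\<epsilon>. A \<epsilon> *v u \<epsilon> - A0 *v u \<epsilon>)" if "\<forall>\<^sub>F \<epsilon> in ?F. norm (u \<epsilon>) = 1" for u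
  proof -
    have "small (\<lambda>\<epsilon>. onorm ((*v) (A \<epsilon> - A0)))"
      using assms(3) by (simp add: vec_bigo_def)
    then show ?thesis
    proof (rule vec_bigo_mono [where C = 1])
      show "\<forall>\<^sub>F \<epsilon> in ?F. norm (A \<epsilon> *v u \<epsilon> - A0 *v u \<epsilon>) \<le> 1 * norm (onorm ((*v) (A \<epsilon> - A0)))"
        using that
      proof eventually_elim
        case (elim \<epsilon>)
        have "norm ((A \<epsilon> - A0) *v u \<epsilon>) \<le> onorm ((*v) (A \<epsilon> - A0)) * norm (u \<epsilon>)"
          by (rule onorm [OF matrix_vector_mul_bounded_linear])
        with elim show ?case
          by (simp add: matrix_vector_mult_diff_rdistrib)
      qed
    qed
  qed
  have pert1: "small (\<lambda>\<epsilon>. A \<epsilon> *v u1 \<epsilon> - A0 *v u1 \<epsilon>)" and pert2: "small (\<lambda>\<epsilon>. A \<epsilon> *v u2 \<epsilon> - A0 *v u2 \<epsilon>)"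
    using basis by (auto intro!: pert elim!: eventually_mono)
  have "bdd (\<lambda>\<epsilon>. (A \<epsilon> *v u2 \<epsilon> - A0 *v u2 \<epsilon>) + A0 *v u2 \<epsilon>)"
    by (intro bdd_intros bu small_imp_bdd [OF pert2])
  then have bs: "bdd s"
    unfolding s_def by (intro bdd_intros bu) simp
  define e1 where "e1 \<epsilon> = A0 *v u1 \<epsilon> - l1 \<epsilon> *s u1 \<epsilon>" for \<epsilon>
  define e2 where "e2 \<epsilon> = A0 *v u2 \<epsilon> - l2 \<epsilon> *s u2 \<epsilon> - s \<epsilon> *s u1 \<epsilon>" for \<epsilon>
  have e1: "small e1"
    by (rule vec_bigo_cong [OF vec_bigo_minus [OF pert1]])
      (use basis in \<open>auto simp: e1_def elim!: eventually_mono\<close>)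
  have e2: "small e2"
    by (rule vec_bigo_eq [OF vec_bigo_diff [OF res pert2]]) (simp add: e2_def res_eq)

  \<comment> \<open>Components orthogonal to the chain\<close>
  obtain K where K: "\<And>l u. l \<in> cball \<mu> r \<Longrightarrow> norm (?Q *v u) \<le> K * norm (?Q *v (A0 *v u - l *s u))"
    using norm_perp_proj_le [OF assms(1,2,4)] by blast
  define q1 q2 where "q1 \<epsilon> = ?Q *v u1 \<epsilon>" and "q2 \<epsilon> = ?Q *v u2 \<epsilon>" for \<epsilon>
  have q1: "small q1"
  proof (rule vec_bigo_mono [where C = K])
    show "small (\<lambda>\<epsilon>. ?Q *v e1 \<epsilon>)"
      by (intro vec_bigo_matrix e1)
    show "\<forall>\<^sub>F \<epsilon> in ?F. norm (q1 \<epsilon>) \<le> K * norm (?Q *v e1 \<epsilon>)"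
      using basis by (auto simp: q1_def e1_def K elim!: eventually_mono)
  qed
  have q2: "small q2"
  proof (rule vec_bigo_mono [where C = K])
    \<comment> \<open>The residual \<open>e2\<close> contains \<open>s\<close> times
      \<open>u1\<close>, whose projection is already known to be small; hence \<open>u1\<close> is
      treated before \<open>u2\<close>.\<close>
    have "small (\<lambda>\<epsilon>. ?Q *v e2 \<epsilon> + s \<epsilon> *s q1 \<epsilon>)"
      by (intro vec_bigo_add vec_bigo_matrix e2 small_smult bs q1)
    then show "small (\<lambda>\<epsilon>. ?Q *v (A0 *v u2 \<epsilon> - l2 \<epsilon> *s u2 \<epsilon>))"
      by (rule vec_bigo_eq) (simp add: e2_def q1_def matrix_vector_mult_diff_distrib vector_scalar_commute)
    show "\<forall>\<^sub>F \<epsilon> in ?F. norm (q2 \<epsilon>) \<le> K * norm (?Q *v (A0 *v u2 \<epsilon> - l2 \<epsilon> *s u2 \<epsilon>))"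
      using basis by (auto simp: q2_def K elim!: eventually_mono)
  qed

  \<comment> \<open>Coordinates along the chain\<close>
  define a1 a2 b1 b2 where "a1 \<epsilon> = hdot x0 (u1 \<epsilon>)" and "a2 \<epsilon> = hdot x0 (u2 \<epsilon>)"
    and "b1 \<epsilon> = inverse J * hdot j0 (u1 \<epsilon>)" and "b2 \<epsilon> = inverse J * hdot j0 (u2 \<epsilon>)" for \<epsilon>
  have ba: "bdd a1" "bdd a2" "bdd b1" "bdd b2"
    unfolding a1_def a2_def b1_def b2_def by (intro bdd_intros bu)+
  have u1_eq: "u1 \<epsilon> = a1 \<epsilon> *s x0 + b1 \<epsilon> *s j0 + q1 \<epsilon>" and u2_eq: "u2 \<epsilon> = a2 \<epsilon> *s x0 + b2 \<epsilon> *s j0 + q2 \<epsilon>" for \<epsilon>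
    unfolding a1_def a2_def b1_def b2_def q1_def q2_def
    by (simp_all add: perp_proj_vec [OF xj0] J_def divide_inverse mult.commute)
  have A0u1: "A0 *v u1 \<epsilon> = (l0 * a1 \<epsilon> + b1 \<epsilon>) *s x0 + (l0 * b1 \<epsilon>) *s j0 + A0 *v q1 \<epsilon>" for \<epsilon>
    by (subst u1_eq) (simp add: matrix_vector_right_distrib vector_scalar_commute Ax0 Aj0 vec_eq_iff algebra_simps)
  have A0u2: "A0 *v u2 \<epsilon> = (l0 * a2 \<epsilon> + b2 \<epsilon>) *s x0 + (l0 * b2 \<epsilon>) *s j0 + A0 *v q2 \<epsilon>" for \<epsilon>
    by (subst u2_eq) (simp add: matrix_vector_right_distrib vector_scalar_commute Ax0 Aj0 vec_eq_iff algebra_simps)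
  define d1 d2 where "d1 \<epsilon> = l1 \<epsilon> - l0" and "d2 \<epsilon> = l2 \<epsilon> - l0" for \<epsilon>
  have bd: "bdd d1" "bdd d2"
    unfolding d1_def d2_def by (intro bdd_intros bl)+
  \<comment> \<open>These are the entries of \<open>N C - C T\<close>, where \<open>C\<close> has
    rows \<open>(a1, a2)\<close> and \<open>(b1, b2)\<close>, \<open>N\<close> is the nilpotent
    Jordan block, and \<open>T\<close> is upper triangular with diagonal \<open>d1, d2\<close> and
    corner \<open>s\<close>. Their smallness says that \<open>C\<close> nearly intertwines
    \<open>N\<close> and \<open>T\<close>.\<close>
  define r1 r1' where "r1 \<epsilon> = b1 \<epsilon> - d1 \<epsilon> * a1 \<epsilon>" and "r1' \<epsilon> = - d1 \<epsilon> * b1 \<epsilon>" for \<epsilon>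
  define r2 r2' where "r2 \<epsilon> = b2 \<epsilon> - d2 \<epsilon> * a2 \<epsilon> - s \<epsilon> * a1 \<epsilon>"
    and "r2' \<epsilon> = - d2 \<epsilon> * b2 \<epsilon> - s \<epsilon> * b1 \<epsilon>" for \<epsilon>
  have "small (\<lambda>\<epsilon>. e1 \<epsilon> - A0 *v q1 \<epsilon> + l1 \<epsilon> *s q1 \<epsilon>)"
    by (intro vec_bigo_add vec_bigo_diff vec_bigo_matrix small_smult e1 q1 bl)
  then have "small (\<lambda>\<epsilon>. r1 \<epsilon> *s x0 + r1' \<epsilon> *s j0)"
    by (rule vec_bigo_eq)
      (simp add: e1_def A0u1, subst u1_eq, simp add: r1_def r1'_def d1_def vec_eq_iff algebra_simps)
  note r1 = small_coords [OF assms(2) j0 this]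
  have "small (\<lambda>\<epsilon>. e2 \<epsilon> - A0 *v q2 \<epsilon> + l2 \<epsilon> *s q2 \<epsilon> + s \<epsilon> *s q1 \<epsilon>)"
    by (intro vec_bigo_add vec_bigo_diff vec_bigo_matrix small_smult e2 q1 q2 bl bs)
  then have "small (\<lambda>\<epsilon>. r2 \<epsilon> *s x0 + r2' \<epsilon> *s j0)"
    by (rule vec_bigo_eq)
      (simp add: e2_def A0u2, subst u1_eq, subst u2_eq, simp add: r2_def r2'_def d2_def vec_eq_iff algebra_simps)
  note r2 = small_coords [OF assms(2) j0 this]

  \<comment> \<open>The Gram determinant of \<open>u1, u2\<close> equals \<open>J * cnj \<Delta> * \<Delta>\<close> up to \<open>O(\<epsilon>)\<close>,
    so \<open>\<Delta>\<close> stays away from zero.\<close>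
  define \<Delta> where "\<Delta> \<epsilon> = a1 \<epsilon> * b2 \<epsilon> - a2 \<epsilon> * b1 \<epsilon>" for \<epsilon>
  have gram: "small (\<lambda>\<epsilon>. hdot (v \<epsilon>) (v' \<epsilon>) - (cnj (a \<epsilon>) * a' \<epsilon> + J * (cnj (b \<epsilon>) * b' \<epsilon>)))"
    if "\<And>\<epsilon>. v \<epsilon> = a \<epsilon> *s x0 + b \<epsilon> *s j0 + q \<epsilon>" "\<And>\<epsilon>. v' \<epsilon> = a' \<epsilon> *s x0 + b' \<epsilon> *s j0 + q' \<epsilon>"
      "small q" "small q'" "bdd v" "bdd a'" "bdd b'" for v v' a a' b b' q q'
  proof -
    have "small (\<lambda>\<epsilon>. hdot (v \<epsilon>) (q' \<epsilon>) + hdot (q \<epsilon>) (a' \<epsilon> *s x0 + b' \<epsilon> *s j0))"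
      by (intro vec_bigo_add small_hdot small_hdot_left bdd_intros that)
    then show ?thesis
      by (rule vec_bigo_eq)
        (simp add: that(1,2) hdot_add hdot_add_left hdot_smult hdot_smult_left dots xj0 algebra_simps)
  qed
  define g11 g12 g22 where "g11 \<epsilon> = cnj (a1 \<epsilon>) * a1 \<epsilon> + J * (cnj (b1 \<epsilon>) * b1 \<epsilon>)"
    and "g12 \<epsilon> = cnj (a1 \<epsilon>) * a2 \<epsilon> + J * (cnj (b1 \<epsilon>) * b2 \<epsilon>)"
    and "g22 \<epsilon> = cnj (a2 \<epsilon>) * a2 \<epsilon> + J * (cnj (b2 \<epsilon>) * b2 \<epsilon>)" for \<epsilon>
  have g11: "small (\<lambda>\<epsilon>. 1 - g11 \<epsilon>)"
    unfolding g11_def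
    by (rule vec_bigo_cong [OF gram [OF u1_eq u1_eq q1 q1 bu(1) ba(1,3)]])
      (use basis in \<open>auto simp: hdot_self elim!: eventually_mono\<close>)
  have g22: "small (\<lambda>\<epsilon>. 1 - g22 \<epsilon>)"
    unfolding g22_def
    by (rule vec_bigo_cong [OF gram [OF u2_eq u2_eq q2 q2 bu(2) ba(2,4)]])
      (use basis in \<open>auto simp: hdot_self elim!: eventually_mono\<close>)
  have g12: "small (\<lambda>\<epsilon>. - g12 \<epsilon>)"
    unfolding g12_def
    by (rule vec_bigo_cong [OF gram [OF u1_eq u2_eq q1 q2 bu(1) ba(2,4)]])
      (use basis in \<open>auto elim!: eventually_mono\<close>)
  have bg: "bdd g22" "bdd g12"
    unfolding g22_def g12_def by (intro bdd_intros ba)+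
  \<comment> \<open>The combination equals \<open>g11 * g22 - cnj g12 * g12 - 1\<close>. The Gram
    determinant formed from the coordinates is exactly
    \<open>J * cnj \<Delta> * \<Delta>\<close>.\<close>
  have "small (\<lambda>\<epsilon>. cnj (g12 \<epsilon>) * (- g12 \<epsilon>) - g22 \<epsilon> * (1 - g11 \<epsilon>) - (1 - g22 \<epsilon>))"
    by (intro vec_bigo_diff small_mult vec_bigo_cnj bg g11 g12 g22)
  then have "small (\<lambda>\<epsilon>. J * cnj (\<Delta> \<epsilon>) * \<Delta> \<epsilon> - 1)"
    by (rule vec_bigo_eq)
      (simp add: g11_def g12_def g22_def \<Delta>_def cnjJ algebra_simps)
  from small_tendsto_0 [OF this] have "((\<lambda>\<epsilon>. J * cnj (\<Delta> \<epsilon>) * \<Delta> \<epsilon>) \<longlongrightarrow> 1) ?F"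
    by (subst (asm) LIM_zero_iff)
  note JD = tendsto_1_inverse [OF this]
  have \<Delta>0: "\<forall>\<^sub>F \<epsilon> in ?F. \<Delta> \<epsilon> \<noteq> 0"
    using JD(2) by (rule eventually_mono) auto
  have b\<Delta>: "bdd \<Delta>"
    unfolding \<Delta>_def by (intro bdd_intros ba)
  have "bdd (\<lambda>\<epsilon>. J * cnj (\<Delta> \<epsilon>) * inverse (J * cnj (\<Delta> \<epsilon>) * \<Delta> \<epsilon>))"
    by (intro bdd_intros JD b\<Delta>)
  then have bi\<Delta>: "bdd (\<lambda>\<epsilon>. inverse (\<Delta> \<epsilon>))"
    by (rule vec_bigo_cong) (use \<Delta>0 J0 in \<open>auto simp: field_simps elim!: eventually_mono\<close>)
  have trace: "small (\<lambda>\<epsilon>. d1 \<epsilon> + d2 \<epsilon>)"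
  proof -
    \<comment> \<open>Up to sign, the bracket is the trace of the adjugate of \<open>C\<close> times
      \<open>N C - C T\<close>. Since \<open>N\<close> has trace zero and \<open>C\<close> has
      determinant \<Delta>, only \<Delta> times the trace of \<open>T\<close> survives.\<close>
    have "small (\<lambda>\<epsilon>. inverse (\<Delta> \<epsilon>) * (b1 \<epsilon> * r2 \<epsilon> - a1 \<epsilon> * r2' \<epsilon> + a2 \<epsilon> * r1' \<epsilon> - b2 \<epsilon> * r1 \<epsilon>))"
      by (intro vec_bigo_diff vec_bigo_add small_mult bi\<Delta> ba r1 r2)
    moreover have id: "b1 \<epsilon> * r2 \<epsilon> - a1 \<epsilon> * r2' \<epsilon> + a2 \<epsilon> * r1' \<epsilon> - b2 \<epsilon> * r1 \<epsilon> = \<Delta> \<epsilon> * (d1 \<epsilon> + d2 \<epsilon>)" for \<epsilon>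
      by (simp add: r1_def r1'_def r2_def r2'_def \<Delta>_def algebra_simps)
    ultimately have "small (\<lambda>\<epsilon>. inverse (\<Delta> \<epsilon>) * (\<Delta> \<epsilon> * (d1 \<epsilon> + d2 \<epsilon>)))"
      by (simp only: id)
    then show ?thesis
      by (rule vec_bigo_cong) (use \<Delta>0 in \<open>auto elim!: eventually_mono\<close>)
  qed

  \<comment> \<open>The entry \<open>s\<close> stays away from zero: \<open>s * a1\<^sup>2 - \<Delta>\<close> tends to zero because \<open>b1\<close> does.\<close>
  have "small (\<lambda>\<epsilon>. b1 \<epsilon> * r1 \<epsilon> - a1 \<epsilon> * r1' \<epsilon>)"
    by (intro vec_bigo_diff small_mult ba r1)
  \<comment> \<open>Eliminating \<open>d1\<close> between \<open>r1\<close> and \<open>r1'\<close>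
    leaves the square of \<open>b1\<close>.\<close>
  then have "small (\<lambda>\<epsilon>. b1 \<epsilon> * b1 \<epsilon>)"
    by (rule vec_bigo_eq) (simp add: r1_def r1'_def algebra_simps)
  then have b1_0: "(b1 \<longlongrightarrow> 0) ?F"
    by (rule tendsto_0_if_square [OF small_tendsto_0])
  \<comment> \<open>The trace estimate exchanges \<open>d2\<close> for \<open>- d1\<close>, and
    \<open>r1\<close> exchanges \<open>d1 * a1\<close> for \<open>b1\<close>; thus \<open>?w\<close>
    is \<open>a1 * b2 + a2 * b1 - s * a1 * a1\<close>, free of both eigenvalues.\<close>
  have "small (\<lambda>\<epsilon>. a1 \<epsilon> * r2 \<epsilon> + a1 \<epsilon> * a2 \<epsilon> * (d1 \<epsilon> + d2 \<epsilon>) + a2 \<epsilon> * r1 \<epsilon>)" (is "small ?w")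
    by (intro vec_bigo_add small_mult bdd_mult ba r1 r2 trace)
  then have "(?w \<longlongrightarrow> 0) ?F"
    by (rule small_tendsto_0)
  then have "((\<lambda>\<epsilon>. 2 * a2 \<epsilon> * b1 \<epsilon> - ?w \<epsilon>) \<longlongrightarrow> 0 - 0) ?F"
    by (intro tendsto_diff bdd_mult_tendsto_0 bdd_mult bdd_const ba b1_0)
  moreover have id: "2 * a2 \<epsilon> * b1 \<epsilon> - ?w \<epsilon> = s \<epsilon> * (a1 \<epsilon> * a1 \<epsilon>) - \<Delta> \<epsilon>" for \<epsilon>
    by (simp add: r1_def r2_def \<Delta>_def algebra_simps)
  ultimately have "((\<lambda>\<epsilon>. s \<epsilon> * (a1 \<epsilon> * a1 \<epsilon>) - \<Delta> \<epsilon>) \<longlongrightarrow> 0) ?F"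
    by (simp only: id diff_zero)
  then have "((\<lambda>\<epsilon>. inverse (\<Delta> \<epsilon>) * (s \<epsilon> * (a1 \<epsilon> * a1 \<epsilon>) - \<Delta> \<epsilon>)) \<longlongrightarrow> 0) ?F"
    by (intro bdd_mult_tendsto_0 bi\<Delta>)
  moreover have "\<forall>\<^sub>F \<epsilon> in ?F. inverse (\<Delta> \<epsilon>) * (s \<epsilon> * (a1 \<epsilon> * a1 \<epsilon>) - \<Delta> \<epsilon>) =
      inverse (\<Delta> \<epsilon>) * (a1 \<epsilon> * a1 \<epsilon>) * s \<epsilon> - 1"
    using \<Delta>0 by (rule eventually_mono) (simp add: field_simps)
  ultimately have "((\<lambda>\<epsilon>. inverse (\<Delta> \<epsilon>) * (a1 \<epsilon> * a1 \<epsilon>) * s \<epsilon> - 1) \<longlongrightarrow> 0) ?F"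
    by (rule Lim_transform_eventually)
  then have "((\<lambda>\<epsilon>. inverse (\<Delta> \<epsilon>) * (a1 \<epsilon> * a1 \<epsilon>) * s \<epsilon>) \<longlongrightarrow> 1) ?F"
    by (subst (asm) LIM_zero_iff)
  note T = tendsto_1_inverse [OF this]
  have s0: "\<forall>\<^sub>F \<epsilon> in ?F. s \<epsilon> \<noteq> 0"
    using T(2) by (rule eventually_mono) auto
  \<comment> \<open>Where \<open>s\<close> is nonzero, its inverse is the bounded cofactor of
    \<open>s\<close> divided by the product that tends to one.\<close>
  have "bdd (\<lambda>\<epsilon>. inverse (\<Delta> \<epsilon>) * (a1 \<epsilon> * a1 \<epsilon>) * inverse (inverse (\<Delta> \<epsilon>) * (a1 \<epsilon> * a1 \<epsilon>) * s \<epsilon>))"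
    by (intro bdd_intros ba bi\<Delta> T(1))
  then have bis: "bdd (\<lambda>\<epsilon>. inverse (s \<epsilon>))"
    by (rule vec_bigo_cong) (use T(2) in \<open>auto simp: field_simps elim!: eventually_mono\<close>)

  \<comment> \<open>The chain built from the basis\<close>
  define \<gamma> where "\<gamma> \<epsilon> = (?S \<epsilon> $ 2 $ 2 - ?S \<epsilon> $ 1 $ 1) / (2 * ?S \<epsilon> $ 1 $ 2)" for \<epsilon>
  define x where "x \<epsilon> = u1 \<epsilon> + \<gamma> \<epsilon> *s u2 \<epsilon>" for \<epsilon>
  define j where "j \<epsilon> = inverse (s \<epsilon>) *s u2 \<epsilon>" for \<epsilon>
  have raw: "raw_chain (A \<epsilon>) (u1 \<epsilon>) (u2 \<epsilon>) = (x \<epsilon>, j \<epsilon>)" for \<epsilon>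
    by (simp add: raw_chain_def Let_def x_def j_def \<gamma>_def schur_block_nth s_def inverse_eq_divide)
  \<comment> \<open>These are the coordinates of \<open>j\<close> along \<open>x0\<close> and
    \<open>j0\<close>. That the \<open>j0\<close> coordinate \<beta> also scales \<open>x0\<close>
    in \<open>x\<close> is the remaining point.\<close>
  define \<alpha> \<beta> where "\<alpha> \<epsilon> = inverse (s \<epsilon>) * a2 \<epsilon>" and "\<beta> \<epsilon> = inverse (s \<epsilon>) * b2 \<epsilon>" for \<epsilon>
  have b\<alpha>: "bdd \<alpha>" and b\<beta>: "bdd \<beta>"
    unfolding \<alpha>_def \<beta>_def by (intro bdd_intros bis ba)+
  have "small (\<lambda>\<epsilon>. inverse (s \<epsilon>) *s q2 \<epsilon>)"
    by (intro small_smult bis q2)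
  then have j: "small (\<lambda>\<epsilon>. j \<epsilon> - (\<alpha> \<epsilon> *s x0 + \<beta> \<epsilon> *s j0))"
    by (rule vec_bigo_eq)
      (simp add: j_def \<alpha>_def \<beta>_def, subst u2_eq, simp add: vec_eq_iff algebra_simps)
  have ortho: "\<forall>\<^sub>F \<epsilon> in ?F. hdot (u1 \<epsilon>) (u1 \<epsilon>) = 1 \<and> hdot (u2 \<epsilon>) (u2 \<epsilon>) = 1 \<and>
      hdot (u1 \<epsilon>) (u2 \<epsilon>) = 0 \<and> hdot (u2 \<epsilon>) (u1 \<epsilon>) = 0 \<and> ?S \<epsilon> $ 1 $ 1 = l1 \<epsilon>"
    using basis
  proof eventually_elim
    case (elim \<epsilon>)
    then show ?case
      using hdot_commute [of "u2 \<epsilon>" "u1 \<epsilon>"]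
      by (simp add: schur_block_nth hdot_smult hdot_self)
  qed
  have "small (\<lambda>\<epsilon>. hdot (u2 \<epsilon>) (res \<epsilon>))"
    by (intro small_hdot bu res)
  \<comment> \<open>With a nonzero tolerance \<open>u2\<close> is only an approximate eigenvector,
    so the Rayleigh quotient differs from \<open>l2\<close> by the component of \<open>res\<close>
    along \<open>u2\<close>.\<close>
  then have s22: "small (\<lambda>\<epsilon>. ?S \<epsilon> $ 2 $ 2 - l2 \<epsilon>)"
    by (rule vec_bigo_cong)
      (use ortho in \<open>auto simp: schur_block_nth res_eq hdot_add hdot_smult elim!: eventually_mono\<close>)
  \<comment> \<open>The relation for \<open>A0 u2\<close> turns \<open>s *s x\<close> into
    \<open>(A0 - l0) u2 - e2\<close> plus a multiple of \<open>u2\<close>. The shift \<gamma> is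
    chosen so that this multiple involves only \<open>d1 + d2\<close> and the error of
    \<open>s22\<close>; with \<open>d2\<close> alone the estimate would lose a square root. The main
    term \<open>(A0 - l0) u2\<close> is \<open>b2 *s x0\<close> plus the contribution of
    \<open>q2\<close>.\<close>
  have "small (\<lambda>\<epsilon>. inverse (s \<epsilon>) *s (A0 *v q2 \<epsilon> - l0 *s q2 \<epsilon> - e2 \<epsilon> +
      (1 / 2 * (?S \<epsilon> $ 2 $ 2 - l2 \<epsilon>) - 1 / 2 * (d1 \<epsilon> + d2 \<epsilon>)) *s u2 \<epsilon>))" (is "small ?f")
    by (intro small_smult [OF bis] vec_bigo_add vec_bigo_diff vec_bigo_matrix q2 e2
        small_smult [OF bdd_const] small_smult_left small_mult [OF bdd_const] s22 trace bu)
  then have x: "small (\<lambda>\<epsilon>. x \<epsilon> - \<beta> \<epsilon> *s x0)"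
  proof (rule vec_bigo_cong)
    show "\<forall>\<^sub>F \<epsilon> in ?F. ?f \<epsilon> = x \<epsilon> - \<beta> \<epsilon> *s x0"
      using s0 ortho
    proof eventually_elim
      case (elim \<epsilon>)
      define \<delta> where "\<delta> = (?S \<epsilon> $ 2 $ 2 - l1 \<epsilon>) / 2"
      have \<gamma>: "\<gamma> \<epsilon> = inverse (s \<epsilon>) * \<delta>"
        using elim by (simp add: \<gamma>_def \<delta>_def schur_block_nth(2) s_def field_simps)
      have \<delta>: "1 / 2 * (?S \<epsilon> $ 2 $ 2 - l2 \<epsilon>) - 1 / 2 * (d1 \<epsilon> + d2 \<epsilon>) = \<delta> - d2 \<epsilon>"
        by (simp add: \<delta>_def d1_def d2_def field_simps)
      have "A0 *v q2 \<epsilon> - l0 *s q2 \<epsilon> = A0 *v u2 \<epsilon> - l0 *s u2 \<epsilon> - b2 \<epsilon> *s x0"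
        unfolding A0u2 by (subst u2_eq) (simp add: vec_eq_iff algebra_simps)
      then have eq: "A0 *v q2 \<epsilon> - l0 *s q2 \<epsilon> - e2 \<epsilon> + (\<delta> - d2 \<epsilon>) *s u2 \<epsilon> = s \<epsilon> *s u1 \<epsilon> + \<delta> *s u2 \<epsilon> - b2 \<epsilon> *s x0"
        by (simp add: e2_def d2_def vec_eq_iff algebra_simps)
      then show ?case
        using elim(1) unfolding \<delta> eq by (simp add: x_def \<gamma> \<beta>_def vec_eq_iff field_simps)
    qed
  qed
  have nx: "\<forall>\<^sub>F \<epsilon> in ?F. 1 \<le> norm (x \<epsilon>)"
    using basis ortho
  proof eventually_elim
    case (elim \<epsilon>)
    then have "hdot (u1 \<epsilon>) (x \<epsilon>) = 1"
      by (simp add: x_def hdot_add hdot_smult)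
    then show ?case
      using norm_hdot_le [of "u1 \<epsilon>" "x \<epsilon>"] elim(1) by simp
  qed
  note N = normalize_chain_perturbation [OF assms(2) x j b\<alpha> b\<beta> nx]
  \<comment> \<open>The phase of \<beta> accounts for the free phases of \<open>u1\<close> and
    \<open>u2\<close>. The value 1 where \<beta> vanishes, which eventually does not happen, gives
    \<open>c\<close> modulus one for every \<epsilon>.\<close>
  define c where "c \<epsilon> = (if \<beta> \<epsilon> = 0 then 1 else sgn (\<beta> \<epsilon>))" for \<epsilon>
  have "small (\<lambda>\<epsilon>. c \<epsilon> *s x0 - approx_x (A \<epsilon>) (u1 \<epsilon>) (u2 \<epsilon>))"
    by (rule vec_bigo_cong [OF N(1)])
      (use N(3) in \<open>auto simp: c_def approx_x_def raw elim!: eventually_mono\<close>)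
  moreover have "small (\<lambda>\<epsilon>. c \<epsilon> *s j0 - approx_j (A \<epsilon>) (u1 \<epsilon>) (u2 \<epsilon>))"
    by (rule vec_bigo_cong [OF N(2)])
      (use N(3) in \<open>auto simp: c_def approx_j_def raw elim!: eventually_mono\<close>)
  moreover have "\<forall>\<epsilon>. norm (c \<epsilon>) = 1"
    by (simp add: c_def norm_sgn)
  ultimately show ?thesis
    unfolding vec_bigo_def by (intro exI [of _ c] conjI)
qed

end
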